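(* Let $E$ be a finite directed graph without sinks or sources in which every cycle has an exit, and let $\mathcal J$ be an admissible set of pairs of paths, with unitary $u_{\mathcal J}\in L_{\mathbb Z}(E)$. Assume that the coding graph $E_{\mathcal J}$ has only non-negative edges and does not contain any non-positive cycles. If the labeled graph $(E_{\mathcal J},\mathcal E)$ is left-synchronizing, then the endomorphism $\Lambda_{\mathcal J}\colon L_{\mathbb Z}(E)\to L_{\mathbb Z}(E)$ restricts to an automorphism of the diagonal subalgebra $\mathcal D_{L_{\mathbb Z}(E)}$.
   Context: Graphs and algebras. $E=(E^0,E^1,r,s)$ is a finite directed graph (multiple edges allowed) with range and source maps $r,s$; no sinks (every vertex emits an edge), no sources (every vertex receives an edge). A path $\mu=\mu_1\cdots\mu_k$ is a sequence of edges with $r(\mu_j)=s(\mu_{j+1})$, of length $|\mu|=k$; vertices are paths of length $0$; $E^*$ is the set of finite paths. A cycle is a path of length $\ge1$ with equal source and range; it has an exit if the source of one of its edges emits at least two distinct edges. $L_{\mathbb Z}(E)$ is the universal $\mathbb Z$-algebra generated by pairwise orthogonal idempotents $P_v$ ($v\in E^0$) and elements $S_e,S_e^*$ ($e\in E^1$) subject to $S_e^*S_f=0$ for $e\ne f$, $S_e^*S_e=P_{r(e)}$, $P_{s(e)}S_e=S_e=S_eP_{r(e)}$, $S_e^*P_{s(e)}=S_e^*=P_{r(e)}S_e^*$, and $P_v=\sum_{s(e)=v}S_eS_e^*$; it is a unital $*$-algebra. $S_\mu=S_{\mu_1}\cdots S_{\mu_k}$, $S_v=P_v$ for $v\in E^0$,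 $P_\mu=S_\mu S_\mu^*$. The diagonal $\mathcal D_{L_{\mathbb Z}(E)}$ is the $\mathbb Z$-span of $\{P_\mu:\mu\in E^*\}$. Admissible sets and endomorphisms. An admissible set is a finite $\mathcal J\subseteq E^*\times E^*$ such that $s(\mu)=s(\nu)$, $r(\mu)=r(\nu)$, $|\nu|\ge 1$ for all $(\mu,\nu)\in\mathcal J$ and $u_{\mathcal J}=\sum_{(\mu,\nu)\in\mathcal J}S_\mu S_\nu^*$ is unitary in $L_{\mathbb Z}(E)$ (equivalently: distinct pairs have distinct first components and distinct second components, and the $P_\mu$ over first components sum to $1$, as do the $P_\nu$ over second components). Elements of $\mathcal J$ are written $(\mu,e\nu)$ with $e\in E^1$, $\nu\in E^*$ ($\nu=r(e)$ if the second component is a single edge). $\Lambda_{\mathcal J}$ is the unital $*$-endomorphism of $L_{\mathbb Z}(E)$ with $\Lambda_{\mathcal J}(S_e)=u_{\mathcal J}S_e$ and $\Lambda_{\mathcal J}(P_v)=P_v$; it is injective and maps $\mathcal D_{L_{\mathbb Z}(E)}$ into itself, and it restricts to an automorphism of the diagonal if and only if $\Lambda_{\mathcal J}(\mathcal D_{L_{\mathbb Z}(E)})=\mathcal D_{L_{\mathbb Z}(E)}$. Coding graph. $E_{\mathcal J}$ has vertex set $\mathcal J$, and exactly one edge $[(\mu_1,e_1\nu_1),(\mu_2,e_2\nu_2)]$ from $(\mu_1,e_1\nu_1)$ to $(\mu_2,e_2\nu_2)$ whenever $S_{\nu_1}^*S_{\mu_2}\neq0$; its label is $\mathcal L_{\mathcal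 J}=S_{\nu_1}^*S_{\mu_2}$, which is of the form $S_\alpha$ ($|\alpha|\geq 1$), $P_v$, or $S_\alpha^*$ ($|\alpha|\ge1$). The degree of the edge is $|\alpha|$, $0$, $-|\alpha|$ respectively. An edge is non-negative if its degree is $\ge0$; a path (in particular a cycle) in $E_{\mathcal J}$ is non-positive if all its edges have degree $\le0$. For a path $\omega$ in $E_{\mathcal J}$ visiting successively the vertices $(\mu_1,e_1\nu_1),\dots,(\mu_k,e_k\nu_k)$, $\mathcal E(\omega)=e_1e_2\cdots e_k\in E^*$. Left-synchronizing. $(E_{\mathcal J},\mathcal E)$ is left-synchronizing if there is $m\in\mathbb N$ (the delay) such that for any two paths $\omega_1,\omega_2$ of length $m$ in $E_{\mathcal J}$, $\mathcal E(\omega_1)=\mathcal E(\omega_2)$ implies $s(\omega_1)=s(\omega_2)$. *)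

theory Defs
  imports
    "HOL-Library.Poly_Mapping"
    "HOL-Algebra.QuotRing"
    "HOL-Algebra.Generated_Groups"
    "Graph_Theory.Arc_Walk"
begin

section \<open>Graphs and paths\<close>

text \<open>
  Directed graphs are those of \<^theory>\<open>Graph_Theory.Digraph\<close>; the source map \<open>s\<close> is
  \<^const>\<open>tail\<close> and the range map \<open>r\<close> is \<^const>\<open>head\<close>. Multiple edges and loops are allowed.
\<close>

definition no_sinks :: "('v,'e) pre_digraph \<Rightarrow> bool" where
  "no_sinks E \<longleftrightarrow> (\<forall>v\<in>verts E. out_arcs E v \<noteq> {})"

definition no_sources :: "('v,'e) pre_digraph \<Rightarrow> bool" where
  "no_sources E \<longleftrightarrow> (\<forall>v\<in>verts E. in_arcs E v \<noteq> {})"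

text \<open>
  A cycle is an arbitrary closed walk of positive length (\<open>closed_w\<close>); repeated vertices
  are allowed, unlike in the library's predicate \<open>cycle\<close>.
\<close>

definition has_exit :: "('v,'e) pre_digraph \<Rightarrow> 'e list \<Rightarrow> bool" where
  "has_exit E p \<longleftrightarrow> (\<exists>e\<in>set p. card (out_arcs E (tail E e)) \<ge> 2)"

definition all_cycles_have_exits :: "('v,'e) pre_digraph \<Rightarrow> bool" where
  "all_cycles_have_exits E \<longleftrightarrow> (\<forall>p. wf_digraph.closed_w E p \<longrightarrow> has_exit E p)"

text \<open>
  A path is a pair of its source and its list of edges, so that \<open>(v, [])\<close> is the path of
  length \<open>0\<close> at the vertex \<open>v\<close>. For a path of positive length the first component is
  determined by the edges.
\<close>

type_synonym ('v,'e) path = "'v \<times> 'e list"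

definition paths :: "('v,'e) pre_digraph \<Rightarrow> ('v,'e) path set" where
  "paths E = {(u, p). \<exists>v. pre_digraph.awalk E u p v}"

definition path_source :: "('v,'e) path \<Rightarrow> 'v" where
  "path_source \<mu> = fst \<mu>"

definition path_range :: "('v,'e) pre_digraph \<Rightarrow> ('v,'e) path \<Rightarrow> 'v" where
  "path_range E \<mu> = pre_digraph.awlast E (fst \<mu>) (snd \<mu>)"

definition path_length :: "('v,'e) path \<Rightarrow> nat" where
  "path_length \<mu> = length (snd \<mu>)"

text \<open>The decomposition \<open>e\<nu>\<close> of a path of positive length into first edge and rest.\<close>

definition path_edge :: "('v,'e) path \<Rightarrow> 'e" where
  "path_edge \<mu> = hd (snd \<mu>)"

definition path_rest :: "('v,'e) pre_digraph \<Rightarrow> ('v,'e) path \<Rightarrow> ('v,'e) path" where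
  "path_rest E \<mu> = (head E (path_edge \<mu>), tl (snd \<mu>))"


section \<open>The free ring on the generators\<close>

text \<open>
  \<open>Vertex v\<close>, \<open>Edge e\<close> and \<open>Ghost e\<close> are the symbols for \<open>P\<^sub>v\<close>, \<open>S\<^sub>e\<close> and \<open>S\<^sub>e\<^sup>*\<close>. The free unital
  \<open>\<int>\<close>-algebra is the monoid ring over \<open>\<int>\<close> of the free monoid of words in these symbols; the
  product of \<open>\<Rightarrow>\<^sub>0\<close> is convolution with respect to \<open>+\<close>, so concatenation of words is
  written additively.
\<close>

datatype ('v,'e) generator = Vertex 'v | Edge 'e | Ghost 'e

datatype ('v,'e) word = Word (letters: "('v,'e) generator list")

instantiation word :: (type, type) monoid_add
begin

definition zero_word :: "('a,'b) word" where
  "zero_word = Word []"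

definition plus_word :: "('a,'b) word \<Rightarrow> ('a,'b) word \<Rightarrow> ('a,'b) word" where
  "plus_word x y = Word (letters x @ letters y)"

instance
  by standard (auto simp: zero_word_def plus_word_def)

end

type_synonym ('v,'e) free_elem = "('v,'e) word \<Rightarrow>\<^sub>0 int"

definition generators :: "('v,'e) pre_digraph \<Rightarrow> ('v,'e) generator set" where
  "generators E = Vertex ` verts E \<union> Edge ` arcs E \<union> Ghost ` arcs E"

definition free_ring :: "('v,'e) pre_digraph \<Rightarrow> ('v,'e) free_elem ring" where
  "free_ring E =
    \<lparr> carrier = {p. \<forall>w\<in>Poly_Mapping.keys p. set (letters w) \<subseteq> generators E},
      mult = (*), one = 1, zero = 0, add = (+) \<rparr>"

lemma ring_free_ring: "ring (free_ring E)"
proof (rule ringI)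
  show "abelian_group (free_ring E)"
  proof (rule abelian_groupI)
    fix x assume "x \<in> carrier (free_ring E)"
    then show "\<exists>y\<in>carrier (free_ring E). y \<oplus>\<^bsub>free_ring E\<^esub> x = \<zero>\<^bsub>free_ring E\<^esub>"
      by (intro bexI[of _ "- x"]) (auto simp: free_ring_def)
  next
    fix x y assume "x \<in> carrier (free_ring E)" "y \<in> carrier (free_ring E)"
    then show "x \<oplus>\<^bsub>free_ring E\<^esub> y \<in> carrier (free_ring E)"
      using keys_add[of x y] by (auto simp: free_ring_def)
  qed (simp_all add: free_ring_def algebra_simps)
  show "Group.monoid (free_ring E)"
    apply (rule monoidI)
    subgoal for x y using keys_mult[of x y] by (fastforce simp: free_ring_def plus_word_def)
    subgoal by (simp add: free_ring_def zero_word_def)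
    by (simp_all add: free_ring_def mult.assoc)
qed (simp_all add: free_ring_def algebra_simps)

definition free_gen :: "('v,'e) generator \<Rightarrow> ('v,'e) free_elem" where
  "free_gen x = Poly_Mapping.single (Word [x]) 1"

fun generator_star :: "('v,'e) generator \<Rightarrow> ('v,'e) generator" where
  "generator_star (Vertex v) = Vertex v"
| "generator_star (Edge e) = Ghost e"
| "generator_star (Ghost e) = Edge e"

definition word_star :: "('v,'e) word \<Rightarrow> ('v,'e) word" where
  "word_star w = Word (rev (map generator_star (letters w)))"

definition free_star :: "('v,'e) free_elem \<Rightarrow> ('v,'e) free_elem" where
  "free_star p =
    (\<Sum>w\<in>Poly_Mapping.keys p. Poly_Mapping.single (word_star w) (Poly_Mapping.lookup p w))"


lemma free_ring_gen_closed:
  "v \<in> verts E \<Longrightarrow> free_gen (Vertex v) \<in> carrier (free_ring E)"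
  "e \<in> arcs E \<Longrightarrow> free_gen (Edge e) \<in> carrier (free_ring E)"
  "e \<in> arcs E \<Longrightarrow> free_gen (Ghost e) \<in> carrier (free_ring E)"
  by (auto simp: free_gen_def free_ring_def generators_def)

lemma free_ring_closed:
  "x \<in> carrier (free_ring E) \<Longrightarrow> y \<in> carrier (free_ring E) \<Longrightarrow> x - y \<in> carrier (free_ring E)"
  "x \<in> carrier (free_ring E) \<Longrightarrow> y \<in> carrier (free_ring E) \<Longrightarrow> x * y \<in> carrier (free_ring E)"
  "1 \<in> carrier (free_ring E)"
  subgoal using keys_diff[of x y] by (auto simp: free_ring_def)
  subgoal using keys_mult[of x y] by (fastforce simp: free_ring_def plus_word_def)
  subgoal by (auto simp: free_ring_def zero_word_def)
  done

lemma free_ring_sum_closed: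
  "finite A \<Longrightarrow> (\<And>a. a \<in> A \<Longrightarrow> f a \<in> carrier (free_ring E)) \<Longrightarrow> sum f A \<in> carrier (free_ring E)"
proof (induction rule: finite_induct)
  case empty
  then show ?case by (auto simp: free_ring_def)
next
  case (insert x F)
  then show ?case
    using keys_add[of "f x" "sum f F"] by (fastforce simp: free_ring_def)
qed


section \<open>The Leavitt path algebra over the integers\<close>

text \<open>
  Each relation \<open>x = y\<close> is imposed by the element \<open>x - y\<close>. As \<open>E\<close> has finitely many vertices,
  the universal algebra on the generators has the unit \<open>\<Sum>\<^sub>v P\<^sub>v\<close>; the relation
  \<open>\<Sum>\<^sub>v P\<^sub>v = 1\<close> identifies that unit with the unit of the free unital algebra.
\<close>

inductive_set leavitt_relations :: "('v,'e) pre_digraph \<Rightarrow> ('v,'e) free_elem set"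
  for E :: "('v,'e) pre_digraph" where
  idempotent:
    "v \<in> verts E \<Longrightarrow> free_gen (Vertex v) * free_gen (Vertex v) - free_gen (Vertex v) \<in> leavitt_relations E"
| orthogonal:
    "v \<in> verts E \<Longrightarrow> w \<in> verts E \<Longrightarrow> v \<noteq> w \<Longrightarrow>
      free_gen (Vertex v) * free_gen (Vertex w) \<in> leavitt_relations E"
| ghost_edge_distinct:
    "e \<in> arcs E \<Longrightarrow> f \<in> arcs E \<Longrightarrow> e \<noteq> f \<Longrightarrow>
      free_gen (Ghost e) * free_gen (Edge f) \<in> leavitt_relations E"
| ghost_edge:
    "e \<in> arcs E \<Longrightarrow>
      free_gen (Ghost e) * free_gen (Edge e) - free_gen (Vertex (head E e)) \<in> leavitt_relations E"
| source_edge: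
    "e \<in> arcs E \<Longrightarrow>
      free_gen (Vertex (tail E e)) * free_gen (Edge e) - free_gen (Edge e) \<in> leavitt_relations E"
| edge_range:
    "e \<in> arcs E \<Longrightarrow>
      free_gen (Edge e) * free_gen (Vertex (head E e)) - free_gen (Edge e) \<in> leavitt_relations E"
| ghost_source:
    "e \<in> arcs E \<Longrightarrow>
      free_gen (Ghost e) * free_gen (Vertex (tail E e)) - free_gen (Ghost e) \<in> leavitt_relations E"
| range_ghost:
    "e \<in> arcs E \<Longrightarrow>
      free_gen (Vertex (head E e)) * free_gen (Ghost e) - free_gen (Ghost e) \<in> leavitt_relations E"
| vertex_sum:
    "v \<in> verts E \<Longrightarrow>
      free_gen (Vertex v) - (\<Sum>e\<in>out_arcs E v. free_gen (Edge e) * free_gen (Ghost e)) \<in> leavitt_relations E"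
| unit_sum:
    "1 - (\<Sum>v\<in>verts E. free_gen (Vertex v)) \<in> leavitt_relations E"

lemma leavitt_relations_carrier:
  assumes "fin_digraph E"
  shows "leavitt_relations E \<subseteq> carrier (free_ring E)"
proof
  interpret fin_digraph E by fact
  fix x assume "x \<in> leavitt_relations E"
  then show "x \<in> carrier (free_ring E)"
    by induction (auto intro!: free_ring_closed free_ring_gen_closed free_ring_sum_closed)
qed

definition leavitt_ideal :: "('v,'e) pre_digraph \<Rightarrow> ('v,'e) free_elem set" where
  "leavitt_ideal E = genideal (free_ring E) (leavitt_relations E)"

definition leavitt :: "('v,'e) pre_digraph \<Rightarrow> ('v,'e) free_elem set ring" where
  "leavitt E = free_ring E Quot leavitt_ideal E"

lemma ideal_leavitt_ideal:
  "fin_digraph E \<Longrightarrow> ideal (leavitt_ideal E) (free_ring E)"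
  unfolding leavitt_ideal_def
  by (rule ring.genideal_ideal[OF ring_free_ring leavitt_relations_carrier])

lemma ring_leavitt: "fin_digraph E \<Longrightarrow> ring (leavitt E)"
  unfolding leavitt_def by (rule ideal.quotient_is_ring[OF ideal_leavitt_ideal])

definition leavitt_gen :: "('v,'e) pre_digraph \<Rightarrow> ('v,'e) generator \<Rightarrow> ('v,'e) free_elem set" where
  "leavitt_gen E x = leavitt_ideal E +>\<^bsub>free_ring E\<^esub> free_gen x"

definition P_vertex :: "('v,'e) pre_digraph \<Rightarrow> 'v \<Rightarrow> ('v,'e) free_elem set" where
  "P_vertex E v = leavitt_gen E (Vertex v)"

definition S_edge :: "('v,'e) pre_digraph \<Rightarrow> 'e \<Rightarrow> ('v,'e) free_elem set" where
  "S_edge E e = leavitt_gen E (Edge e)"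

text \<open>
  The ideal is invariant under \<^const>\<open>free_star\<close>, so the image of a coset is the coset of the
  adjoints of its representatives.
\<close>

definition leavitt_star :: "('v,'e) free_elem set \<Rightarrow> ('v,'e) free_elem set" where
  "leavitt_star X = free_star ` X"

definition S_path :: "('v,'e) pre_digraph \<Rightarrow> ('v,'e) path \<Rightarrow> ('v,'e) free_elem set" where
  "S_path E \<mu> =
    (if snd \<mu> = [] then P_vertex E (fst \<mu>)
     else foldr (mult (leavitt E)) (map (S_edge E) (snd \<mu>)) \<one>\<^bsub>leavitt E\<^esub>)"

definition P_path :: "('v,'e) pre_digraph \<Rightarrow> ('v,'e) path \<Rightarrow> ('v,'e) free_elem set" where
  "P_path E \<mu> = S_path E \<mu> \<otimes>\<^bsub>leavitt E\<^esub> leavitt_star (S_path E \<mu>)"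

text \<open>The \<open>\<int>\<close>-span of a set is the additive subgroup that it generates.\<close>

definition diagonal :: "('v,'e) pre_digraph \<Rightarrow> ('v,'e) free_elem set set" where
  "diagonal E = generate (add_monoid (leavitt E)) (P_path E ` paths E)"

definition diagonal_ring :: "('v,'e) pre_digraph \<Rightarrow> ('v,'e) free_elem set ring" where
  "diagonal_ring E = (leavitt E)\<lparr>carrier := diagonal E\<rparr>"


section \<open>Admissible sets and their endomorphisms\<close>

definition u_elem ::
    "('v,'e) pre_digraph \<Rightarrow> (('v,'e) path \<times> ('v,'e) path) set \<Rightarrow> ('v,'e) free_elem set" where
  "u_elem E J =
    finsum (leavitt E) (\<lambda>(\<mu>, \<nu>). S_path E \<mu> \<otimes>\<^bsub>leavitt E\<^esub> leavitt_star (S_path E \<nu>)) J"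

definition is_unitary :: "('v,'e) pre_digraph \<Rightarrow> ('v,'e) free_elem set \<Rightarrow> bool" where
  "is_unitary E u \<longleftrightarrow>
    u \<in> carrier (leavitt E) \<and>
    leavitt_star u \<otimes>\<^bsub>leavitt E\<^esub> u = \<one>\<^bsub>leavitt E\<^esub> \<and> u \<otimes>\<^bsub>leavitt E\<^esub> leavitt_star u = \<one>\<^bsub>leavitt E\<^esub>"

definition admissible ::
    "('v,'e) pre_digraph \<Rightarrow> (('v,'e) path \<times> ('v,'e) path) set \<Rightarrow> bool" where
  "admissible E J \<longleftrightarrow>
    finite J \<and> J \<subseteq> paths E \<times> paths E \<and>
    (\<forall>(\<mu>, \<nu>)\<in>J. path_source \<mu> = path_source \<nu> \<and> path_range E \<mu> = path_range E \<nu> \<and>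
                path_length \<nu> \<ge> 1) \<and>
    is_unitary E (u_elem E J)"

definition unital_star_endo ::
    "('v,'e) pre_digraph \<Rightarrow> (('v,'e) free_elem set \<Rightarrow> ('v,'e) free_elem set) \<Rightarrow> bool" where
  "unital_star_endo E \<phi> \<longleftrightarrow>
    \<phi> \<in> ring_hom (leavitt E) (leavitt E) \<and>
    (\<forall>x\<in>carrier (leavitt E). \<phi> (leavitt_star x) = leavitt_star (\<phi> x))"

text \<open>
  The endomorphism is determined on the carrier by its values on generators; \<open>extensional\<close>
  fixes its values elsewhere.
\<close>

definition Lambda ::
    "('v,'e) pre_digraph \<Rightarrow> (('v,'e) path \<times> ('v,'e) path) set \<Rightarrow>
      ('v,'e) free_elem set \<Rightarrow> ('v,'e) free_elem set" where
  "Lambda E J =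
    (THE \<phi>. \<phi> \<in> extensional (carrier (leavitt E)) \<and> unital_star_endo E \<phi> \<and>
       (\<forall>e\<in>arcs E. \<phi> (S_edge E e) = u_elem E J \<otimes>\<^bsub>leavitt E\<^esub> S_edge E e) \<and>
       (\<forall>v\<in>verts E. \<phi> (P_vertex E v) = P_vertex E v))"


section \<open>The coding graph\<close>

type_synonym ('v,'e) coding_vertex = "('v,'e) path \<times> ('v,'e) path"

text \<open>
  A vertex \<open>(\<mu>, e\<nu>)\<close> is a pair whose second component is the whole path \<open>e\<nu>\<close>; \<open>e\<close> and \<open>\<nu>\<close> are
  recovered with \<^const>\<open>path_edge\<close> and \<^const>\<open>path_rest\<close>. There is at most one edge from one
  vertex to another, so an edge is the pair of its end points.
\<close>

fun coding_label ::
    "('v,'e) pre_digraph \<Rightarrow> ('v,'e) coding_vertex \<times> ('v,'e) coding_vertex \<Rightarrow>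
      ('v,'e) free_elem set" where
  "coding_label E ((\<mu>\<^sub>1, \<kappa>\<^sub>1), (\<mu>\<^sub>2, \<kappa>\<^sub>2)) =
    leavitt_star (S_path E (path_rest E \<kappa>\<^sub>1)) \<otimes>\<^bsub>leavitt E\<^esub> S_path E \<mu>\<^sub>2"

definition coding_graph ::
    "('v,'e) pre_digraph \<Rightarrow> ('v,'e) coding_vertex set \<Rightarrow>
      (('v,'e) coding_vertex, ('v,'e) coding_vertex \<times> ('v,'e) coding_vertex) pre_digraph" where
  "coding_graph E J =
    \<lparr> verts = J, arcs = {a \<in> J \<times> J. coding_label E a \<noteq> \<zero>\<^bsub>leavitt E\<^esub>}, tail = fst, head = snd \<rparr>"

text \<open>The label \<open>P\<^sub>v\<close> is the case of a path \<open>\<alpha>\<close> of length \<open>0\<close>, in which both forms agree.\<close>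

definition edge_degree ::
    "('v,'e) pre_digraph \<Rightarrow> ('v,'e) coding_vertex \<times> ('v,'e) coding_vertex \<Rightarrow> int" where
  "edge_degree E a =
    (THE d. \<exists>\<alpha>\<in>paths E.
       coding_label E a = S_path E \<alpha> \<and> d = int (path_length \<alpha>) \<or>
       coding_label E a = leavitt_star (S_path E \<alpha>) \<and> d = - int (path_length \<alpha>))"

definition non_negative_edge ::
    "('v,'e) pre_digraph \<Rightarrow> ('v,'e) coding_vertex \<times> ('v,'e) coding_vertex \<Rightarrow> bool" where
  "non_negative_edge E a \<longleftrightarrow> edge_degree E a \<ge> 0"

definition non_positive_path ::
    "('v,'e) pre_digraph \<Rightarrow> (('v,'e) coding_vertex \<times> ('v,'e) coding_vertex) list \<Rightarrow> bool" where
  "non_positive_path E \<omega> \<longleftrightarrow> (\<forall>a\<in>set \<omega>. edge_degree E a \<le> 0)"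

text \<open>
  \<open>edge_word E J x \<omega>\<close> is the path \<open>e\<^sub>1e\<^sub>2\<dots>e\<^sub>k\<close>, as a list of edges of \<open>E\<close>, for the path \<open>\<omega>\<close> in the
  coding graph that starts at \<open>x\<close>. It has one edge for each vertex visited, hence one more than
  the length of \<open>\<omega>\<close>.
\<close>

definition edge_word ::
    "('v,'e) pre_digraph \<Rightarrow> ('v,'e) coding_vertex set \<Rightarrow> ('v,'e) coding_vertex \<Rightarrow>
      (('v,'e) coding_vertex \<times> ('v,'e) coding_vertex) list \<Rightarrow> 'e list" where
  "edge_word E J x \<omega> =
    map (\<lambda>y. path_edge (snd y)) (pre_digraph.awalk_verts (coding_graph E J) x \<omega>)"

definition left_synchronizing ::
    "('v,'e) pre_digraph \<Rightarrow> ('v,'e) coding_vertex set \<Rightarrow> bool" where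
  "left_synchronizing E J \<longleftrightarrow>
    (\<exists>m::nat. \<forall>x\<^sub>1 \<omega>\<^sub>1 y\<^sub>1 x\<^sub>2 \<omega>\<^sub>2 y\<^sub>2.
       pre_digraph.awalk (coding_graph E J) x\<^sub>1 \<omega>\<^sub>1 y\<^sub>1 \<and> length \<omega>\<^sub>1 = m \<and>
       pre_digraph.awalk (coding_graph E J) x\<^sub>2 \<omega>\<^sub>2 y\<^sub>2 \<and> length \<omega>\<^sub>2 = m \<and>
       edge_word E J x\<^sub>1 \<omega>\<^sub>1 = edge_word E J x\<^sub>2 \<omega>\<^sub>2 \<longrightarrow> x\<^sub>1 = x\<^sub>2)"

end

theory Submission
  imports Defs "HOL-Library.Function_Algebras" "HOL-Library.Stream" "HOL-Library.Sublist"
begin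

text \<open>
  A diagonal element \<open>d\<close> is determined by its compressions \<open>S\<^sub>\<lambda>\<^sup>* d S\<^sub>\<lambda>\<close>, which for long paths \<open>\<lambda>\<close>
  are integer multiples of vertex projections. As \<open>\<Lambda>\<close> fixes these, and no nonzero multiple of them
  vanishes, it is injective on the diagonal. For surjectivity, expand \<open>\<Lambda>(S\<^sub>e)\<close>, \<open>e = e\<^sub>1\<dots>e\<^sub>N\<close>, as
  a sum over the paths \<open>\<omega>\<close> in the coding graph with edge word \<open>e\<close>. If \<open>\<omega>\<close> visits the vertices
  \<open>(\<mu>\<^sub>i, e\<^sub>i\<nu>\<^sub>i)\<close>, non-negativity gives \<open>\<mu>\<^sub>i\<^sub>+\<^sub>1 = \<nu>\<^sub>i\<alpha>\<^sub>i\<close>, and the summand is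
  \<open>S\<^sub>\<tau>S\<^sub>\<nu>\<^sup>*\<close> with \<open>\<tau> = \<mu>\<^sub>1\<alpha>\<^sub>1\<alpha>\<^sub>2\<dots>\<close> and \<open>\<nu> = \<nu>\<^sub>N\<close>. Without non-positive cycles \<open>\<tau>\<close> grows with \<open>N\<close>, and by left
  synchronization all \<open>\<omega>\<close> with the same edge word share all but the end of their vertices. Hence for large \<open>N\<close>
  either \<open>P\<^sub>\<kappa>\<Lambda>(P\<^sub>e) = \<Lambda>(P\<^sub>e)\<close> or \<open>P\<^sub>\<kappa>\<Lambda>(P\<^sub>e) = 0\<close>, and summing over \<open>e\<close> exhibits
  \<open>P\<^sub>\<kappa>\<close> as an element of \<open>\<Lambda>(D)\<close>, where \<open>D\<close> is the diagonal.
\<close>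

section \<open>The free ring\<close>

text \<open>In a quotient by relations, equations are easy to derive and hard to refute. Three steps
  need refutations: nonzero multiples of vertex projections survive; the degree of an edge of the
  coding graph is well defined; and distinct pairs with the same source have incomparable second
  components, so that \<open>\<Lambda>\<close> preserves the diagonal. All three are read off from
  one representation on functions of infinite paths, whose powers of 2 make it sensitive to lengths.
  For surjectivity the length N is \<open>K + m\<close>, where m is the delay: synchronization
  determines the K initial vertices of \<omega> from the edge word. Among any card J + 1 consecutive
  vertices one repeats, and the resulting cycle has an edge of positive degree. Hence K can be taken
  so large that these vertices already fix |\<kappa>| initial edges of \<tau>. So for one edge word
  either all \<tau> begin with \<kappa> or none does, and P_\<kappa>S_\<tau> is S_\<tau> or 0
  accordingly.\<close>

lemma letters_simps [simp]:
  "letters (x + y) = letters x @ letters y" "letters 0 = []"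
  by (auto simp: plus_word_def zero_word_def)

lemma frag_induct [case_names zero one diff]:
  assumes "P 0" "\<And>x. P (frag_of x)" "\<And>a b. P a \<Longrightarrow> P b \<Longrightarrow> P (a - b)"
  shows "P c"
  using assms by (intro frag_induction [of c UNIV P]) auto

text \<open>Words are products of generators and integer coefficients arise from differences, so
  statements about homomorphisms reduce to generators. The induction covers the whole type, not only
  the carrier.\<close>

lemma free_induct [case_names one gen diff mult]:
  fixes p :: "('v,'e) free_elem"
  assumes one: "P 1"
    and gen: "\<And>g. P (free_gen g)"
    and diff: "\<And>p q. P p \<Longrightarrow> P q \<Longrightarrow> P (p - q)"
    and mult: "\<And>p q. P p \<Longrightarrow> P q \<Longrightarrow> P (p * q)"
  shows "P p"
proof -
  have word: "P (frag_of (Word ls))" for ls :: "('v,'e) generator list"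
  proof (induction ls)
    case Nil
    then show ?case using one by (simp add: zero_word_def [symmetric])
  next
    case (Cons g ls)
    have "frag_of (Word (g # ls)) = free_gen g * frag_of (Word ls)"
      by (simp add: free_gen_def mult_single plus_word_def)
    then show ?case using gen mult Cons by simp
  qed
  have "P 0" using diff [OF one one] by simp
  moreover have "P (frag_of w)" for w using word [of "letters w"] by simp
  ultimately show ?thesis
    using diff by (intro frag_induct [of P p]) auto
qed

text \<open>One construction serves twice: with left multiplications for \<open>G\<close> it gives
  the homomorphism \<open>free_lift\<close>, with \<open>rep\<close> for \<open>G\<close> the
  representation on functions. The ring structure of \<open>'m\<close> supplies the integer scalars;
  additivity of each \<open>G g\<close> is enough for products to act by composition.\<close>

definition free_act :: "(('v,'e) generator \<Rightarrow> 'm::ring_1 \<Rightarrow> 'm) \<Rightarrow> ('v,'e) free_elem \<Rightarrow> 'm \<Rightarrow> 'm" where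
  "free_act G p m = (\<Sum>w\<in>Poly_Mapping.keys p. of_int (Poly_Mapping.lookup p w) * foldr G (letters w) m)"

lemma free_act_add: "free_act G (p + q) m = free_act G p m + free_act G q m"
  unfolding free_act_def by (rule setsum_keys_plus_distrib) (simp_all add: distrib_right)

lemma free_act_zero [simp]: "free_act G 0 m = 0"
  by (simp add: free_act_def)

lemma free_act_diff: "free_act G (p - q) m = free_act G p m - free_act G q m"
  using free_act_add [of G "p - q" q m] by simp

lemma free_act_one [simp]: "free_act G 1 m = m"
  by (simp add: free_act_def)

lemma free_act_gen [simp]: "free_act G (free_gen g) m = G g m"
  by (simp add: free_act_def free_gen_def)

lemma free_act_of_int [simp]: "free_act G (of_int k) m = of_int k * m"
  by (cases "k = 0") (simp_all add: free_act_def flip: single_of_int)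

lemma free_act_sum: "free_act G (sum f A) m = (\<Sum>a\<in>A. free_act G (f a) m)"
  by (induction A rule: infinite_finite_induct) (simp_all add: free_act_add)

lemma free_act_diff_right:
  assumes "\<And>g x y. G g (x - y) = G g x - G g y"
  shows "free_act G p (x - y) = free_act G p x - free_act G p y"
proof -
  have "foldr G ls (x - y) = foldr G ls x - foldr G ls y" for ls
    by (induction ls) (simp_all add: assms)
  then show ?thesis by (simp add: free_act_def right_diff_distrib sum_subtractf)
qed

lemma free_act_mult:
  fixes G :: "('v,'e) generator \<Rightarrow> 'm::ring_1 \<Rightarrow> 'm"
  assumes G: "\<And>g x y. G g (x - y) = G g x - G g y"
  shows "free_act G (p * q) m = free_act G p (free_act G q m)"
proof -
  have frag: "free_act G (frag_of w * q) m = free_act G (frag_of w) (free_act G q m)" for w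
  proof (induction q rule: frag_induct)
    case zero
    have "free_act G (frag_of w) (0 - 0) = (0::'m)"
      by (subst free_act_diff_right [OF G]) simp
    then show ?case by simp
  next
    case (one w')
    then show ?case by (simp add: mult_single free_act_def)
  qed (simp_all add: right_diff_distrib free_act_diff free_act_diff_right [OF G])
  show ?thesis
    by (induction p rule: frag_induct)
      (simp_all add: left_diff_distrib free_act_diff frag)
qed

definition free_lift :: "(('v,'e) generator \<Rightarrow> 'm::ring_1) \<Rightarrow> ('v,'e) free_elem \<Rightarrow> 'm" where
  "free_lift h p = free_act (\<lambda>g. (*) (h g)) p 1"

lemma free_lift_simps [simp]:
  "free_lift h 0 = 0"
  "free_lift h 1 = 1"
  "free_lift h (free_gen g) = h g"
  "free_lift h (of_int k) = of_int k"
  by (simp_all add: free_lift_def)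

lemma free_lift_add: "free_lift h (p + q) = free_lift h p + free_lift h q"
  and free_lift_diff: "free_lift h (p - q) = free_lift h p - free_lift h q"
  and free_lift_sum: "free_lift h (sum f A) = (\<Sum>a\<in>A. free_lift h (f a))"
  by (simp_all add: free_lift_def free_act_add free_act_diff free_act_sum)

lemma free_lift_mult: "free_lift h (p * q) = free_lift h p * free_lift h q"
proof -
  let ?a = "free_act (\<lambda>g. (*) (h g))"
  \<comment> \<open>An action by left multiplications is itself left multiplication by its value at
    \<open>1\<close>.\<close>
  have a: "?a p m = ?a p 1 * m" for p m
  proof (induction p arbitrary: m rule: free_induct)
    case (mult p q)
    have pq: "?a (p * q) m = ?a p (?a q m)" for m
      by (rule free_act_mult) (simp add: right_diff_distrib)
    have "?a (p * q) m = ?a p 1 * (?a q 1 * m)"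
      unfolding pq by (rule trans [OF mult.IH(1) arg_cong [OF mult.IH(2)]])
    moreover have "?a (p * q) 1 = ?a p 1 * ?a q 1"
      unfolding pq by (rule mult.IH(1))
    ultimately show ?case
      by (simp only: mult.assoc)
  next
    case (diff p q)
    show ?case
      unfolding free_act_diff left_diff_distrib
      using diff.IH(1) [of m] diff.IH(2) [of m] by (simp only:)
  qed simp_all
  have "?a (p * q) 1 = ?a p (?a q 1)"
    by (rule free_act_mult) (simp add: right_diff_distrib)
  also have "\<dots> = ?a p 1 * ?a q 1"
    by (rule a)
  finally show ?thesis by (simp only: free_lift_def)
qed

section \<open>The adjoint on the free ring\<close>

lemma free_star_add: "free_star (p + q) = free_star p + free_star q"
  unfolding free_star_def by (rule setsum_keys_plus_distrib) (simp_all add: single_add)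

lemma free_star_zero [simp]: "free_star 0 = 0"
  by (simp add: free_star_def)

lemma free_star_diff: "free_star (p - q) = free_star p - free_star q"
  using free_star_add [of "p - q" q] by simp

lemma free_star_sum: "free_star (sum f A) = (\<Sum>a\<in>A. free_star (f a))"
  by (induction A rule: infinite_finite_induct) (simp_all add: free_star_add)

lemma free_star_one [simp]: "free_star 1 = 1"
  by (simp add: free_star_def word_star_def zero_word_def [symmetric])

lemma free_star_gen [simp]: "free_star (free_gen g) = free_gen (generator_star g)"
  by (simp add: free_star_def free_gen_def word_star_def)

lemma free_star_mult: "free_star (p * q) = free_star q * free_star p"
proof -
  have frag: "free_star (frag_of w * q) = free_star q * free_star (frag_of w)" for w
    by (induction q rule: frag_induct)
      (simp_all add: right_diff_distrib left_diff_distrib free_star_diff, 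
       simp add: free_star_def mult_single word_star_def plus_word_def)
  show ?thesis
    by (induction p rule: frag_induct)
      (simp_all add: left_diff_distrib right_diff_distrib free_star_diff frag)
qed

lemma generator_star_star [simp]: "generator_star (generator_star g) = g"
  by (cases g) simp_all

lemma free_star_star [simp]: "free_star (free_star p) = p"
  by (induction p rule: free_induct) (simp_all add: free_star_diff free_star_mult)

lemma free_star_prod_list: "free_star (prod_list ps) = prod_list (rev (map free_star ps))"
  by (induction ps) (simp_all add: free_star_mult)

lemma sum_fun_apply: "(\<Sum>a\<in>A. f a) x = (\<Sum>a\<in>A. f a x)"
  by (induction A rule: infinite_finite_induct) simp_all

lemma of_int_fun_apply [simp]: "of_int k x = of_int k"
proof (cases k rule: int_diff_cases)
  case (diff m n)
  then show ?thesis by simp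
qed

section \<open>Congruence modulo the Leavitt ideal\<close>

locale leavitt_graph = fin_digraph E for E :: "('v,'e) pre_digraph"
begin

text \<open>
  Killing the generators outside \<open>E\<close> extends the congruence modulo the ideal to the whole type, so
  that no membership in the carrier has to be tracked.
\<close>

definition restr :: "('v,'e) free_elem \<Rightarrow> ('v,'e) free_elem" where
  "restr = free_lift (\<lambda>g. if g \<in> generators E then free_gen g else 0)"

definition lcong :: "('v,'e) free_elem \<Rightarrow> ('v,'e) free_elem \<Rightarrow> bool" (infix "\<doteq>" 50) where
  "p \<doteq> q \<longleftrightarrow> restr (p - q) \<in> leavitt_ideal E"

definition qt :: "('v,'e) free_elem \<Rightarrow> ('v,'e) free_elem set" where
  "qt p = leavitt_ideal E +>\<^bsub>free_ring E\<^esub> restr p"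

lemma free_ring_simps [simp]:
  "p \<otimes>\<^bsub>free_ring E\<^esub> q = p * q" "p \<oplus>\<^bsub>free_ring E\<^esub> q = p + q"
  "\<one>\<^bsub>free_ring E\<^esub> = 1" "\<zero>\<^bsub>free_ring E\<^esub> = 0"
  by (simp_all add: free_ring_def)

lemma free_ring_zero_closed: "0 \<in> carrier (free_ring E)"
  by (simp add: free_ring_def)

lemma free_ring_uminus:
  assumes "p \<in> carrier (free_ring E)" shows "\<ominus>\<^bsub>free_ring E\<^esub> p = - p"
proof -
  interpret ring "free_ring E" by (rule ring_free_ring)
  have "- p \<in> carrier (free_ring E)"
    using assms by (simp add: free_ring_def)
  then show ?thesis using assms by (intro minus_equality) simp_all
qed

text \<open>Minimality of the generated ideal, in a form that asks only for differences and
  two-sided multiples. \<open>K\<close> contains \<open>0\<close> because it contains a relation,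
  hence its difference with itself.\<close>

lemma leavitt_ideal_subset:
  assumes rel: "leavitt_relations E \<subseteq> K" and carr: "K \<subseteq> carrier (free_ring E)"
    and diff: "\<And>p q. p \<in> K \<Longrightarrow> q \<in> K \<Longrightarrow> p - q \<in> K"
    and left: "\<And>a p. a \<in> carrier (free_ring E) \<Longrightarrow> p \<in> K \<Longrightarrow> a * p \<in> K"
    and right: "\<And>a p. a \<in> carrier (free_ring E) \<Longrightarrow> p \<in> K \<Longrightarrow> p * a \<in> K"
  shows "leavitt_ideal E \<subseteq> K"
proof -
  interpret ring "free_ring E" by (rule ring_free_ring)
  have "1 - (\<Sum>v\<in>verts E. free_gen (Vertex v)) \<in> K"
    using rel leavitt_relations.unit_sum by blast
  from diff [OF this this] have zero: "0 \<in> K" by simp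
  have uminus: "- p \<in> K" if "p \<in> K" for p
    using diff [OF zero that] by simp
  have add: "p + q \<in> K" if "p \<in> K" "q \<in> K" for p q
    using diff [OF that(1) uminus [OF that(2)]] by simp
  have "subgroup K (add_monoid (free_ring E))"
  proof (rule add.subgroupI)
    show "\<ominus>\<^bsub>free_ring E\<^esub> p \<in> K" if "p \<in> K" for p
      using uminus [OF that] free_ring_uminus [of p] that carr by auto
  qed (use zero add carr in auto)
  then have "ideal K (free_ring E)"
    using left right by (intro idealI ring_axioms) simp_all
  then show ?thesis
    unfolding leavitt_ideal_def using rel by (rule genideal_minimal)
qed

lemma leavitt_ideal_closed:
  shows "p \<in> leavitt_ideal E \<Longrightarrow> q \<in> leavitt_ideal E \<Longrightarrow> p - q \<in> leavitt_ideal E"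
    and "p \<in> leavitt_ideal E \<Longrightarrow> q \<in> leavitt_ideal E \<Longrightarrow> p + q \<in> leavitt_ideal E"
    and "a \<in> carrier (free_ring E) \<Longrightarrow> p \<in> leavitt_ideal E \<Longrightarrow> a * p \<in> leavitt_ideal E"
    and "a \<in> carrier (free_ring E) \<Longrightarrow> p \<in> leavitt_ideal E \<Longrightarrow> p * a \<in> leavitt_ideal E"
    and "0 \<in> leavitt_ideal E"
    and "p \<in> leavitt_ideal E \<Longrightarrow> p \<in> carrier (free_ring E)"
    and "r \<in> leavitt_relations E \<Longrightarrow> r \<in> leavitt_ideal E"
proof -
  interpret ideal "leavitt_ideal E" "free_ring E"
    by (rule ideal_leavitt_ideal) unfold_locales
  show carr: "p \<in> leavitt_ideal E \<Longrightarrow> p \<in> carrier (free_ring E)" for p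
    by (rule Icarr)
  show add: "p \<in> leavitt_ideal E \<Longrightarrow> q \<in> leavitt_ideal E \<Longrightarrow> p + q \<in> leavitt_ideal E" for p q
    using additive_subgroup.a_closed [OF additive_subgroup_axioms, of p q] by simp
  show "p \<in> leavitt_ideal E \<Longrightarrow> q \<in> leavitt_ideal E \<Longrightarrow> p - q \<in> leavitt_ideal E"
    using add [of p "- q"] additive_subgroup.a_inv_closed [OF additive_subgroup_axioms, of q] free_ring_uminus [of q] carr [of q] by simp
  show "a \<in> carrier (free_ring E) \<Longrightarrow> p \<in> leavitt_ideal E \<Longrightarrow> a * p \<in> leavitt_ideal E"
    using I_l_closed [of p a] by simp
  show "a \<in> carrier (free_ring E) \<Longrightarrow> p \<in> leavitt_ideal E \<Longrightarrow> p * a \<in> leavitt_ideal E"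
    using I_r_closed [of p a] by simp
  show "0 \<in> leavitt_ideal E"
    using additive_subgroup.zero_closed [OF additive_subgroup_axioms] by simp
  show "r \<in> leavitt_relations E \<Longrightarrow> r \<in> leavitt_ideal E"
    using genideal_self [OF leavitt_relations_carrier] fin_digraph_axioms
    unfolding leavitt_ideal_def by blast
qed

lemma restr_simps [simp]:
  "restr 0 = 0" "restr 1 = 1"
  "restr (p + q) = restr p + restr q" "restr (p - q) = restr p - restr q"
  "restr (p * q) = restr p * restr q" "restr (sum f A) = (\<Sum>a\<in>A. restr (f a))"
  "restr (free_gen g) = (if g \<in> generators E then free_gen g else 0)"
  by (simp_all add: restr_def free_lift_add free_lift_diff free_lift_mult free_lift_sum)

lemma restr_carrier [simp]: "restr p \<in> carrier (free_ring E)"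
proof (induction p rule: free_induct)
  case (gen g)
  then show ?case
    by (auto simp: free_ring_zero_closed generators_def intro: free_ring_gen_closed)
qed (auto intro: free_ring_closed)

lemma restr_idem:
  assumes "p \<in> carrier (free_ring E)"
  shows "restr p = p"
proof (rule frag_induction [of p "{w. set (letters w) \<subseteq> generators E}"])
  have "restr (frag_of (Word ls)) = frag_of (Word ls)"
    if "set ls \<subseteq> generators E" for ls
    using that
  proof (induction ls)
    case Nil
    have "frag_of (Word []) = (1 :: ('v,'e) free_elem)"
      by (simp add: zero_word_def [symmetric])
    then show ?case by simp
  next
    case (Cons g ls)
    have "frag_of (Word (g # ls)) = free_gen g * frag_of (Word ls)"
      by (simp add: free_gen_def mult_single plus_word_def)
    then show ?case using Cons by simp
  qed
  then show "restr (frag_of w) = frag_of w" if "w \<in> {w. set (letters w) \<subseteq> generators E}" for w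
    using that by (metis mem_Collect_eq word.exhaust_sel)
qed (use assms in \<open>auto simp: free_ring_def\<close>)

lemma restr_restr [simp]: "restr (restr p) = restr p"
  by (rule restr_idem) simp

lemma lcong_refl [simp, intro]: "p \<doteq> p"
  by (simp add: lcong_def leavitt_ideal_closed)

lemma lcong_zero_iff: "p \<doteq> q \<longleftrightarrow> p - q \<doteq> 0"
  by (simp add: lcong_def)

lemma lcong_add: "p \<doteq> p' \<Longrightarrow> q \<doteq> q' \<Longrightarrow> p + q \<doteq> p' + q'"
  unfolding lcong_def using leavitt_ideal_closed(2) [of "restr (p - p')" "restr (q - q')"]
  by (simp add: algebra_simps)

lemma lcong_diff: "p \<doteq> p' \<Longrightarrow> q \<doteq> q' \<Longrightarrow> p - q \<doteq> p' - q'"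
  unfolding lcong_def using leavitt_ideal_closed(1) [of "restr (p - p')" "restr (q - q')"]
  by (simp add: algebra_simps)

lemma lcong_trans [trans]:
  assumes "p \<doteq> q" "q \<doteq> r" shows "p \<doteq> r"
  using lcong_add [OF assms] by (simp add: lcong_def)

lemma lcong_sym: "p \<doteq> q \<Longrightarrow> q \<doteq> p"
  using lcong_diff [of p p p q] lcong_add [of "p - p" "p - q" q q] by simp

lemma lcong_mult:
  assumes "p \<doteq> p'" "q \<doteq> q'" shows "p * q \<doteq> p' * q'"
proof -
  have "p * q \<doteq> p' * q"
    using leavitt_ideal_closed(4) [OF restr_carrier, of "restr (p - p')" q] assms(1)
    by (simp add: lcong_def left_diff_distrib)
  also have "\<dots> \<doteq> p' * q'"
    using leavitt_ideal_closed(3) [OF restr_carrier, of "restr (q - q')" p'] assms(2)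
    by (simp add: lcong_def right_diff_distrib)
  finally show ?thesis .
qed

lemma lcong_sandwich: "p \<doteq> q \<Longrightarrow> a * p * b \<doteq> a * q * b"
  by (intro lcong_mult lcong_refl)

lemma lcong_sum: "(\<And>a. a \<in> A \<Longrightarrow> f a \<doteq> g a) \<Longrightarrow> sum f A \<doteq> sum g A"
  by (induction A rule: infinite_finite_induct) (auto intro: lcong_add)

lemma lcong_sum_zero: "(\<And>a. a \<in> A \<Longrightarrow> f a \<doteq> 0) \<Longrightarrow> sum f A \<doteq> 0"
  using lcong_sum [of A f "\<lambda>_. 0"] by simp

lemma lcong_mult_zero: "p \<doteq> 0 \<Longrightarrow> a * p \<doteq> 0" "p \<doteq> 0 \<Longrightarrow> p * a \<doteq> 0" "p \<doteq> 0 \<Longrightarrow> a * p * b \<doteq> 0"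
  using lcong_mult [of a a p 0] lcong_mult [of p 0 a a] lcong_mult [of "a * p" 0 b b] by auto

lemma lcong_restr: "restr p \<doteq> p"
  by (simp add: lcong_def leavitt_ideal_closed)

text \<open>The carrier elements that \<open>h\<close> sends to zero form an ideal containing the
  relations. The disjunction in \<open>mult\<close> admits antihomomorphisms, so that the adjoint
  and \<open>phi\<close> are both covered; \<open>gen\<close> makes \<open>h\<close> compatible with
  \<open>restr\<close>, as \<open>p\<close> and \<open>q\<close> range over the whole type.\<close>

lemma lcong_hom:
  assumes rel: "\<And>r. r \<in> leavitt_relations E \<Longrightarrow> h r \<doteq> 0"
    and diff: "\<And>p q. h (p - q) = h p - h q"
    and mult: "(\<forall>p q. h (p * q) = h p * h q) \<or> (\<forall>p q. h (p * q) = h q * h p)"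
    and one: "h 1 = 1"
    and gen: "\<And>g. g \<notin> generators E \<Longrightarrow> h (free_gen g) \<doteq> 0"
    and "p \<doteq> q"
  shows "h p \<doteq> h q"
proof -
  have h0: "h 0 = 0" using diff [of 0 0] by simp
  have hrestr: "h (restr p) \<doteq> h p" for p
  proof (induction p rule: free_induct)
    case (gen g)
    then show ?case using assms(5) [of g] by (auto simp: h0 intro: lcong_sym)
  next
    case (mult p q)
    then show ?case using assms(3) by (auto intro: lcong_mult)
  qed (simp_all add: diff lcong_diff)
  let ?K = "{r \<in> carrier (free_ring E). h r \<doteq> 0}"
  have "leavitt_ideal E \<subseteq> ?K"
  proof (rule leavitt_ideal_subset)
    show "leavitt_relations E \<subseteq> ?K"
      using rel leavitt_relations_carrier fin_digraph_axioms by blast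
  next
    fix p q assume "p \<in> ?K" "q \<in> ?K"
    then show "p - q \<in> ?K"
      using lcong_diff [of "h p" 0 "h q" 0] by (simp add: diff free_ring_closed)
  next
    fix a p assume "a \<in> carrier (free_ring E)" "p \<in> ?K"
    then show "a * p \<in> ?K" "p * a \<in> ?K"
      using mult lcong_mult_zero [of "h p" "h a"] by (auto simp: free_ring_closed)
  qed auto
  then have "h (restr (p - q)) \<doteq> 0"
    using \<open>p \<doteq> q\<close> by (auto simp: lcong_def)
  with hrestr have "h (p - q) \<doteq> 0"
    by (rule lcong_trans [OF lcong_sym])
  then show ?thesis by (simp add: diff flip: lcong_zero_iff)
qed

section \<open>The quotient map onto the Leavitt path algebra\<close>

lemma qt_alt: "qt p = {x \<in> carrier (free_ring E). x \<doteq> p}"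
proof (intro Set.set_eqI iffI)
  fix x assume "x \<in> qt p"
  then obtain h where h: "h \<in> leavitt_ideal E" "x = h + restr p"
    by (auto simp: qt_def a_r_coset_def')
  from h(1) have "h \<in> carrier (free_ring E)" by (rule leavitt_ideal_closed)
  with h have "restr x = x" by (simp add: restr_idem)
  with h show "x \<in> {x \<in> carrier (free_ring E). x \<doteq> p}"
    using restr_carrier [of x] by (simp add: lcong_def)
next
  fix x assume "x \<in> {x \<in> carrier (free_ring E). x \<doteq> p}"
  then have "x - restr p \<in> leavitt_ideal E"
    by (auto simp: lcong_def restr_idem)
  then show "x \<in> qt p"
    by (force simp: qt_def a_r_coset_def')
qed

lemma qt_eq_iff: "qt p = qt q \<longleftrightarrow> p \<doteq> q"
proof
  have "restr p \<in> qt p"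
    by (simp add: qt_alt lcong_restr)
  moreover assume "qt p = qt q"
  ultimately have "restr p \<in> qt q" by (simp only:)
  then have "restr p \<doteq> q" by (simp add: qt_alt)
  then show "p \<doteq> q" using lcong_restr lcong_sym lcong_trans by blast
next
  assume "p \<doteq> q"
  then show "qt p = qt q"
    using lcong_sym lcong_trans unfolding qt_alt by blast
qed

lemma qt_hom:
  "qt (p + q) = qt p \<oplus>\<^bsub>leavitt E\<^esub> qt q"
  "qt (p * q) = qt p \<otimes>\<^bsub>leavitt E\<^esub> qt q"
  "qt 1 = \<one>\<^bsub>leavitt E\<^esub>"
  "qt p \<in> carrier (leavitt E)"
proof -
  interpret ideal "leavitt_ideal E" "free_ring E"
    by (rule ideal_leavitt_ideal) unfold_locales
  note hom = rcos_ring_hom [folded leavitt_def]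
  show "qt (p + q) = qt p \<oplus>\<^bsub>leavitt E\<^esub> qt q" "qt (p * q) = qt p \<otimes>\<^bsub>leavitt E\<^esub> qt q"
    using ring_hom_add [OF hom, of "restr p" "restr q"] ring_hom_mult [OF hom, of "restr p" "restr q"]
    by (simp_all add: qt_def)
  show "qt 1 = \<one>\<^bsub>leavitt E\<^esub>"
    using ring_hom_one [OF hom] by (simp add: qt_def)
  show "qt p \<in> carrier (leavitt E)"
    using ring_hom_closed [OF hom, of "restr p"] by (simp add: qt_def)
qed

lemma ring_L: "ring (leavitt E)"
  by (rule ring_leavitt) unfold_locales

lemma qt_zero: "qt 0 = \<zero>\<^bsub>leavitt E\<^esub>"
proof -
  interpret L: ring "leavitt E" by (rule ring_L)
  show ?thesis
    using qt_hom(1) [of 0 0] L.add.r_cancel_one [OF qt_hom(4) qt_hom(4), of 0 0] by simp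
qed

lemma qt_uminus: "\<ominus>\<^bsub>leavitt E\<^esub> qt p = qt (- p)"
proof -
  interpret L: ring "leavitt E" by (rule ring_L)
  have "qt (- p) \<oplus>\<^bsub>leavitt E\<^esub> qt p = \<zero>\<^bsub>leavitt E\<^esub>"
    by (simp flip: qt_hom(1) qt_zero)
  then show ?thesis by (rule L.minus_equality) (simp_all add: qt_hom)
qed

lemma qt_sum: "finite A \<Longrightarrow> qt (sum f A) = finsum (leavitt E) (\<lambda>a. qt (f a)) A"
proof -
  interpret L: ring "leavitt E" by (rule ring_L)
  show "finite A \<Longrightarrow> ?thesis"
    by (induction A rule: finite_induct) (simp_all add: qt_zero qt_hom)
qed

lemma carrier_leavittE:
  assumes "X \<in> carrier (leavitt E)"
  obtains p where "X = qt p"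
proof -
  obtain p where "p \<in> carrier (free_ring E)" "X = leavitt_ideal E +>\<^bsub>free_ring E\<^esub> p"
    using assms by (auto simp: leavitt_def FactRing_def A_RCOSETS_def')
  then have "X = qt p" by (simp add: qt_def restr_idem)
  then show thesis by (rule that)
qed

lemma leavitt_gen_eq: "g \<in> generators E \<Longrightarrow> leavitt_gen E g = qt (free_gen g)"
  by (simp add: leavitt_gen_def qt_def)

section \<open>The defining relations as congruences\<close>

abbreviation P :: "'v \<Rightarrow> ('v,'e) free_elem" where "P v \<equiv> free_gen (Vertex v)"
abbreviation S :: "'e \<Rightarrow> ('v,'e) free_elem" where "S e \<equiv> free_gen (Edge e)"
abbreviation T :: "'e \<Rightarrow> ('v,'e) free_elem" where "T e \<equiv> free_gen (Ghost e)"

lemma outside_zero: "g \<notin> generators E \<Longrightarrow> free_gen g \<doteq> 0"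
  by (simp add: lcong_def leavitt_ideal_closed)

lemma relation_zero: "r \<in> leavitt_relations E \<Longrightarrow> r \<doteq> 0"
  using leavitt_ideal_closed(6,7) by (simp add: lcong_def restr_idem)

text \<open>No membership is assumed: outside the graph \<open>P v\<close> is congruent to
  \<open>0\<close>, and the formula persists.\<close>

lemma P_mult: "P v * P w \<doteq> (if v = w then P v else 0)"
proof (cases "v \<in> verts E \<and> w \<in> verts E")
  case True
  then show ?thesis
    using relation_zero [OF idempotent, of v] relation_zero [OF orthogonal, of v w]
    by (auto simp flip: lcong_zero_iff)
next
  case False
  then have "P v \<doteq> 0 \<or> P w \<doteq> 0"
    using outside_zero [of "Vertex v"] outside_zero [of "Vertex w"]
    by (auto simp: generators_def)
  then show ?thesis
    using lcong_mult_zero(1) [of "P w" "P v"] lcong_mult_zero(2) [of "P v" "P w"]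
    by (auto dest: lcong_sym intro: lcong_trans)
qed

lemma T_S: "e \<in> arcs E \<Longrightarrow> f \<in> arcs E \<Longrightarrow> T e * S f \<doteq> (if e = f then P (head E e) else 0)"
  using relation_zero [OF ghost_edge, of e] relation_zero [OF ghost_edge_distinct, of e f]
  by (auto simp flip: lcong_zero_iff)

lemma P_S: "e \<in> arcs E \<Longrightarrow> P (tail E e) * S e \<doteq> S e"
  and S_P: "e \<in> arcs E \<Longrightarrow> S e * P (head E e) \<doteq> S e"
  and T_P: "e \<in> arcs E \<Longrightarrow> T e * P (tail E e) \<doteq> T e"
  and P_T: "e \<in> arcs E \<Longrightarrow> P (head E e) * T e \<doteq> T e"
  by (subst lcong_zero_iff, rule relation_zero, rule leavitt_relations.intros, assumption)+

lemma P_sum: "v \<in> verts E \<Longrightarrow> P v \<doteq> (\<Sum>e\<in>out_arcs E v. S e * T e)"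
  and one_sum: "1 \<doteq> (\<Sum>v\<in>verts E. P v)"
  by (subst lcong_zero_iff, rule relation_zero, rule leavitt_relations.intros, assumption?)+

text \<open>The adjoint permutes the defining relations, exchanging those for edges with those for
  ghosts.\<close>

lemma free_star_lcong:
  assumes "p \<doteq> q" shows "free_star p \<doteq> free_star q"
proof (rule lcong_hom [OF _ free_star_diff _ free_star_one _ assms])
  fix r assume "r \<in> leavitt_relations E"
  then have "free_star r \<in> leavitt_relations E"
    by (cases, auto simp: free_star_diff free_star_mult free_star_sum intro: leavitt_relations.intros)
  then show "free_star r \<doteq> 0" by (rule relation_zero)
next
  fix g :: "('v,'e) generator" assume "g \<notin> generators E"
  then have "generator_star g \<notin> generators E"
    by (cases g) (auto simp: generators_def)
  then show "free_star (free_gen g) \<doteq> 0"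
    by (simp add: outside_zero)
qed (simp add: free_star_mult)

text \<open>As \<open>leavitt_star\<close> is the image of a coset, both inclusions are needed; the
  second follows from the first because \<open>free_star\<close> is an involution.\<close>

lemma leavitt_star_qt: "leavitt_star (qt p) = qt (free_star p)"
proof -
  have restr_star: "restr (free_star p) = free_star (restr p)" for p
  proof (induction p rule: free_induct)
    case (gen g)
    show ?case by (cases g) (auto simp: generators_def)
  qed (simp_all add: free_star_diff free_star_mult)
  have "free_star x \<in> carrier (free_ring E)" if "x \<in> carrier (free_ring E)" for x
    using restr_star [of x] restr_idem [OF that] restr_carrier [of "free_star x"] by simp
  then have sub: "free_star ` qt p \<subseteq> qt (free_star p)" for p
    by (auto simp: qt_alt free_star_lcong)
  have "qt (free_star p) \<subseteq> free_star ` free_star ` qt (free_star p)"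
    by (simp add: image_image)
  also have "\<dots> \<subseteq> free_star ` qt p"
    using sub [of "free_star p"] by (intro image_mono) simp
  finally show ?thesis unfolding leavitt_star_def using sub by blast
qed

section \<open>Paths and the diagonal\<close>

text \<open>The factor \<open>P u\<close> treats empty and nonempty paths alike; on a nonempty walk
  from \<open>u\<close> it is absorbed by the first edge.\<close>

definition spath :: "'v \<Rightarrow> 'e list \<Rightarrow> ('v,'e) free_elem" where
  "spath u p = P u * prod_list (map S p)"

definition tpath :: "'v \<Rightarrow> 'e list \<Rightarrow> ('v,'e) free_elem" where
  "tpath u p = prod_list (rev (map T p)) * P u"

lemma free_star_spath [simp]: "free_star (spath u p) = tpath u p"
  by (simp add: spath_def tpath_def free_star_mult free_star_prod_list comp_def)

lemma free_star_tpath [simp]: "free_star (tpath u p) = spath u p"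
  by (simp flip: free_star_spath)

lemma spath_Nil [simp]: "spath u [] = P u" and tpath_Nil [simp]: "tpath u [] = P u"
  by (simp_all add: spath_def tpath_def)

lemma spath_Cons:
  assumes "e \<in> arcs E"
  shows "spath (tail E e) (e # p) \<doteq> S e * spath (head E e) p"
proof -
  have "spath (tail E e) (e # p) = 1 * (P (tail E e) * S e) * prod_list (map S p)"
    by (simp add: spath_def mult.assoc)
  also have "\<dots> \<doteq> 1 * S e * prod_list (map S p)"
    by (rule lcong_sandwich [OF P_S [OF assms]])
  also have "\<dots> \<doteq> 1 * (S e * P (head E e)) * prod_list (map S p)"
    by (rule lcong_sandwich [OF lcong_sym [OF S_P [OF assms]]])
  also have "\<dots> = S e * spath (head E e) p"
    by (simp add: spath_def mult.assoc)
  finally show ?thesis .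
qed

lemma tpath_Cons:
  assumes "e \<in> arcs E"
  shows "tpath (tail E e) (e # p) \<doteq> tpath (head E e) p * T e"
  using free_star_lcong [OF spath_Cons [OF assms, of p]] by (simp add: free_star_mult)

lemma P_spath: "P v * spath u p \<doteq> (if v = u then spath u p else 0)"
  using lcong_sandwich [OF P_mult [of v u], of 1 "prod_list (map S p)"]
  by (simp add: spath_def mult.assoc split: if_splits)

lemma tpath_P: "tpath u p * P v \<doteq> (if v = u then tpath u p else 0)"
  using free_star_lcong [OF P_spath [of v u p]] by (simp add: free_star_mult split: if_splits)

lemma spath_append:
  assumes "awalk u (p @ q) w" "awalk u p v"
  shows "spath u (p @ q) \<doteq> spath u p * spath v q"
  using assms
proof (induction p arbitrary: u)
  case Nil
  then show ?case
    using P_spath [of u u q] by (auto simp: awalk_Nil_iff intro: lcong_sym)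
next
  case (Cons e p)
  then have e: "e \<in> arcs E" "u = tail E e"
    and IH: "spath (head E e) (p @ q) \<doteq> spath (head E e) p * spath v q"
    by (auto simp: awalk_Cons_iff simp del: awalk_append_iff)
  have "spath u ((e # p) @ q) \<doteq> S e * spath (head E e) (p @ q)"
    using spath_Cons [OF e(1)] e by simp
  also have "\<dots> \<doteq> S e * (spath (head E e) p * spath v q)"
    by (intro lcong_mult IH lcong_refl)
  also have "\<dots> = S e * spath (head E e) p * spath v q"
    by (simp add: mult.assoc)
  also have "\<dots> \<doteq> spath u (e # p) * spath v q"
    unfolding e(2) by (intro lcong_mult lcong_refl lcong_sym [OF spath_Cons] e)
  finally show ?case .
qed

lemma spath_P:
  assumes "awalk u p v"
  shows "spath u p * P v \<doteq> spath u p"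
  using spath_append [of u p "[]" v v] assms by (auto intro: lcong_sym)

lemma tpath_spath_same:
  assumes "awalk u p v"
  shows "tpath u p * spath u p \<doteq> P v"
  using assms
proof (induction p arbitrary: u)
  case Nil
  then show ?case using P_mult [of u u] by (simp add: awalk_Nil_iff)
next
  case (Cons e p)
  then have e: "e \<in> arcs E" "u = tail E e" "awalk (head E e) p v"
    by (auto simp: awalk_Cons_iff)
  have "tpath u (e # p) * spath u (e # p) \<doteq> (tpath (head E e) p * T e) * (S e * spath (head E e) p)"
    unfolding e(2) by (intro lcong_mult tpath_Cons spath_Cons e)
  also have "\<dots> = tpath (head E e) p * (T e * S e) * spath (head E e) p"
    by (simp add: mult.assoc)
  also have "\<dots> \<doteq> tpath (head E e) p * P (head E e) * spath (head E e) p"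
    using T_S [of e e] e by (intro lcong_sandwich) simp
  also have "\<dots> \<doteq> tpath (head E e) p * spath (head E e) p"
    using tpath_P [of "head E e" p "head E e"] by (intro lcong_mult) simp_all
  also have "\<dots> \<doteq> P v"
    by (rule Cons.IH) fact
  finally show ?case .
qed

lemma tpath_spath_append:
  assumes "awalk u p v" "awalk u (p @ q) w"
  shows "tpath u p * spath u (p @ q) \<doteq> spath v q"
proof -
  have "tpath u p * spath u (p @ q) \<doteq> tpath u p * (spath u p * spath v q)"
    by (intro lcong_mult lcong_refl spath_append [OF assms(2,1)])
  also have "\<dots> \<doteq> P v * spath v q"
    using lcong_mult [OF tpath_spath_same [OF assms(1)], of "spath v q" "spath v q"]
    by (simp add: mult.assoc)
  also have "\<dots> \<doteq> spath v q"
    using P_spath [of v v q] by simp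
  finally show ?thesis .
qed

lemma tpath_append_spath:
  assumes "awalk u p v" "awalk u (p @ q) w"
  shows "tpath u (p @ q) * spath u p \<doteq> tpath v q"
  using free_star_lcong [OF tpath_spath_append [OF assms]] by (simp add: free_star_mult)

section \<open>Path projections and compressions of diagonal elements\<close>

definition proj :: "'v \<Rightarrow> 'e list \<Rightarrow> ('v,'e) free_elem" where
  "proj u p = spath u p * tpath u p"

lemma proj_Nil: "proj u [] \<doteq> P u"
  using P_mult [of u u] by (simp add: proj_def)

lemma proj_Cons:
  assumes "e \<in> arcs E"
  shows "proj (tail E e) (e # p) \<doteq> S e * proj (head E e) p * T e"
  using lcong_mult [OF spath_Cons [OF assms] tpath_Cons [OF assms], of p p]
  by (simp add: proj_def mult.assoc)

text \<open>Representatives of the elements of the diagonal. Closure under congruence lets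
  membership be shown up to the relations; \<open>diagonal_eq\<close> makes the link to
  \<open>diagonal\<close>.\<close>

inductive_set diag :: "('v,'e) free_elem set" where
  zero: "0 \<in> diag"
| path: "awalk u p v \<Longrightarrow> proj u p \<in> diag"
| diff: "d \<in> diag \<Longrightarrow> d' \<in> diag \<Longrightarrow> d - d' \<in> diag"
| lcong: "d \<in> diag \<Longrightarrow> d' \<doteq> d \<Longrightarrow> d' \<in> diag"

lemma diag_uminus: "d \<in> diag \<Longrightarrow> - d \<in> diag"
  using diag.diff [OF diag.zero, of d] by simp

lemma diag_add: "d \<in> diag \<Longrightarrow> d' \<in> diag \<Longrightarrow> d + d' \<in> diag"
  using diag.diff [OF _ diag_uminus, of d d'] by simp

lemma diag_sum: "(\<And>a. a \<in> A \<Longrightarrow> f a \<in> diag) \<Longrightarrow> sum f A \<in> diag"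
  by (induction A rule: infinite_finite_induct) (auto intro: diag.zero diag_add)

lemma diag_zeroI: "d \<doteq> 0 \<Longrightarrow> d \<in> diag"
  by (rule diag.lcong [OF diag.zero])

lemma diag_sandwich:
  assumes "d \<in> diag" and "\<And>u p v. awalk u p v \<Longrightarrow> a * proj u p * b \<in> diag"
  shows "a * d * b \<in> diag"
  using assms(1)
proof induction
  case (diff d d')
  then show ?case using diag.diff [of "a * d * b" "a * d' * b"] by (simp add: algebra_simps)
next
  case (lcong d d')
  then show ?case using lcong_sandwich diag.lcong by blast
qed (use assms(2) in \<open>auto intro: diag.zero\<close>)

lemma diag_sandwich_zero:
  assumes "d \<in> diag" and "\<And>u p v. awalk u p v \<Longrightarrow> a * proj u p * b \<doteq> 0"
  shows "a * d * b \<doteq> 0"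
  using assms(1)
proof induction
  case (diff d d')
  then show ?case using lcong_diff [of "a * d * b" 0 "a * d' * b" 0] by (simp add: algebra_simps)
next
  case (lcong d d')
  then show ?case using lcong_sandwich lcong_trans by blast
qed (use assms(2) in auto)

lemma P_proj_P:
  "P v * proj u p * P w \<doteq> (if v = u \<and> w = u then proj u p else 0)"
proof -
  have "P v * proj u p * P w = (P v * spath u p) * (tpath u p * P w)"
    by (simp add: proj_def mult.assoc)
  also have "\<dots> \<doteq> (if v = u then spath u p else 0) * (if w = u then tpath u p else 0)"
    by (intro lcong_mult P_spath tpath_P)
  finally show ?thesis by (auto simp: proj_def)
qed

text \<open>Thanks to \<open>tl [] = []\<close> the empty path, where \<open>P u\<close> is
  absorbed, shares the formula with walks that begin with \<open>e\<close>, where that edge is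
  stripped.\<close>

lemma T_proj_S:
  assumes "awalk u p v" "e \<in> arcs E" "f \<in> arcs E"
  shows "T e * proj u p * S f \<doteq> (if e = f \<and> u = tail E e \<and> (p = [] \<or> e = hd p)
    then proj (head E e) (tl p) else 0)"
proof (cases p)
  case Nil
  have "T e * proj u p * S f \<doteq> T e * P u * S f"
    using proj_Nil Nil by (intro lcong_sandwich) simp
  also have "\<dots> \<doteq> T e * P (tail E e) * P u * S f"
    using T_P [OF assms(2)] by (intro lcong_mult) (auto intro: lcong_sym)
  also have "\<dots> = T e * (P (tail E e) * P u) * S f"
    by (simp add: mult.assoc)
  also have "\<dots> \<doteq> T e * (if tail E e = u then P (tail E e) else 0) * S f"
    by (intro lcong_sandwich P_mult)
  also have "\<dots> = (if tail E e = u then T e * P (tail E e) * S f else 0)"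
    by simp
  also have "\<dots> \<doteq> (if tail E e = u then T e * S f else 0)"
    by (auto intro!: lcong_mult T_P assms)
  also have "\<dots> \<doteq> (if tail E e = u \<and> e = f then P (head E e) else 0)"
    using T_S [OF assms(2,3)] by (auto split: if_splits)
  also have "\<dots> \<doteq> (if tail E e = u \<and> e = f then proj (head E e) [] else 0)"
    using lcong_sym [OF proj_Nil] by auto
  finally show ?thesis
    using Nil by (auto split: if_splits)
next
  case (Cons g q)
  then have g: "g \<in> arcs E" "u = tail E g"
    using assms by (auto simp: awalk_Cons_iff)
  have "T e * proj u p * S f \<doteq> T e * (S g * proj (head E g) q * T g) * S f"
    using proj_Cons [OF g(1), of q] Cons g by (intro lcong_sandwich) simp
  also have "\<dots> = (T e * S g) * proj (head E g) q * (T g * S f)"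
    by (simp add: mult.assoc)
  also have "\<dots> \<doteq> (if e = g then P (head E e) else 0) * proj (head E g) q * (if g = f then P (head E g) else 0)"
    by (intro lcong_mult T_S assms g lcong_refl)
  also have "\<dots> = (if e = g \<and> g = f then P (head E g) * proj (head E g) q * P (head E g) else 0)"
    by simp
  also have "\<dots> \<doteq> (if e = g \<and> g = f then proj (head E g) q else 0)"
    using P_proj_P [of "head E g" "head E g" q "head E g"] by auto
  finally show ?thesis
    using Cons g by (auto split: if_splits)
qed

lemma S_proj_T:
  assumes "e \<in> arcs E"
  shows "S e * proj u p * T e \<doteq> (if u = head E e then proj (tail E e) (e # p) else 0)"
proof -
  have "S e * proj u p * T e \<doteq> (S e * P (head E e)) * proj u p * (P (head E e) * T e)"
    using assms by (intro lcong_mult lcong_refl lcong_sym [OF S_P] lcong_sym [OF P_T])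
  also have "\<dots> = S e * (P (head E e) * proj u p * P (head E e)) * T e"
    by (simp add: mult.assoc)
  also have "\<dots> \<doteq> S e * (if u = head E e then proj u p else 0) * T e"
    using P_proj_P [of "head E e" u p "head E e"] by (intro lcong_sandwich) auto
  also have "\<dots> = (if u = head E e then S e * proj (head E e) p * T e else 0)"
    by simp
  also have "\<dots> \<doteq> (if u = head E e then proj (tail E e) (e # p) else 0)"
    using lcong_sym [OF proj_Cons [OF assms]] by simp
  finally show ?thesis .
qed

lemma T_diag_S: "d \<in> diag \<Longrightarrow> e \<in> arcs E \<Longrightarrow> T e * d * S e \<in> diag"
proof (erule diag_sandwich)
  fix u p v assume *: "awalk u p v" "e \<in> arcs E"
  have "proj (head E e) (tl p) \<in> diag" if "p = [] \<or> e = hd p"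
  proof (cases p)
    case Nil
    then show ?thesis using * by (intro diag.path [of _ _ "head E e"]) (simp add: awalk_Nil_iff)
  next
    case (Cons f q)
    then show ?thesis using * that by (intro diag.path [of _ _ v]) (simp add: awalk_Cons_iff)
  qed
  then show "T e * proj u p * S e \<in> diag"
    using T_proj_S [OF *(1,2,2)] by (auto intro: diag.lcong diag_zeroI split: if_splits)
qed

lemma T_diag_S_zero: "d \<in> diag \<Longrightarrow> e \<in> arcs E \<Longrightarrow> f \<in> arcs E \<Longrightarrow> e \<noteq> f \<Longrightarrow> T e * d * S f \<doteq> 0"
  using T_proj_S [of _ _ _ e f] by (auto intro: diag_sandwich_zero)

lemma P_diag_P: "d \<in> diag \<Longrightarrow> P v * d * P v \<in> diag"
proof (erule diag_sandwich)
  fix u p w assume "awalk u p w"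
  then show "P v * proj u p * P v \<in> diag"
    using P_proj_P [of v u p v] by (auto intro: diag.lcong diag_zeroI diag.path split: if_splits)
qed

lemma P_diag_P_zero: "d \<in> diag \<Longrightarrow> v \<noteq> w \<Longrightarrow> P v * d * P w \<doteq> 0"
  by (erule diag_sandwich_zero, rule lcong_trans [OF P_proj_P]) auto

lemma S_diag_T: "d \<in> diag \<Longrightarrow> e \<in> arcs E \<Longrightarrow> S e * d * T e \<in> diag"
proof (erule diag_sandwich)
  fix u p v assume *: "awalk u p v" "e \<in> arcs E"
  show "S e * proj u p * T e \<in> diag"
  proof (cases "u = head E e")
    case True
    then have "proj (tail E e) (e # p) \<in> diag"
      using * by (intro diag.path [of _ _ v]) (simp add: awalk_Cons_iff)
    then show ?thesis using S_proj_T [OF *(2), of u p] True by (auto intro: diag.lcong)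
  next
    case False
    then show ?thesis using S_proj_T [OF *(2), of u p] by (auto intro: diag_zeroI)
  qed
qed

lemma spath_diag_tpath: "awalk u p v \<Longrightarrow> d \<in> diag \<Longrightarrow> spath u p * d * tpath u p \<in> diag"
proof (induction p arbitrary: u)
  case Nil
  then show ?case by (simp add: P_diag_P)
next
  case (Cons e p)
  then have e: "e \<in> arcs E" "u = tail E e" "spath (head E e) p * d * tpath (head E e) p \<in> diag"
    by (auto simp: awalk_Cons_iff)
  have "S e * (spath (head E e) p * d * tpath (head E e) p) * T e \<in> diag"
    by (intro S_diag_T e)
  moreover have "spath u (e # p) * d * tpath u (e # p) \<doteq>
      (S e * spath (head E e) p) * d * (tpath (head E e) p * T e)"
    unfolding e(2) by (intro lcong_mult spath_Cons tpath_Cons e lcong_refl)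
  ultimately show ?case
    by (auto intro: diag.lcong simp: mult.assoc)
qed

lemma tpath_diag_spath: "awalk u p v \<Longrightarrow> d \<in> diag \<Longrightarrow> tpath u p * d * spath u p \<in> diag"
proof (induction p arbitrary: u d)
  case Nil
  then show ?case by (simp add: P_diag_P)
next
  case (Cons e p)
  then have e: "e \<in> arcs E" "u = tail E e" "awalk (head E e) p v"
    by (auto simp: awalk_Cons_iff)
  have "tpath (head E e) p * (T e * d * S e) * spath (head E e) p \<in> diag"
    by (intro Cons.IH e T_diag_S Cons.prems)
  moreover have "tpath u (e # p) * d * spath u (e # p) \<doteq>
      (tpath (head E e) p * T e) * d * (S e * spath (head E e) p)"
    unfolding e(2) by (intro lcong_mult spath_Cons tpath_Cons e lcong_refl)
  ultimately show ?case
    by (auto intro: diag.lcong simp: mult.assoc)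
qed

text \<open>Equal first edges are stripped, which replaces \<open>d\<close> by the diagonal element
  \<open>T e * d * S e\<close>; where the walks first disagree, \<open>T_diag_S_zero\<close>
  applies. So diagonal elements have no off-diagonal corners.\<close>

lemma tpath_diag_spath_parallel:
  assumes "awalk u p v" "awalk u q w" "p \<parallel> q" "d \<in> diag"
  shows "tpath u p * d * spath u q \<doteq> 0"
  using assms
proof (induction p arbitrary: u q d)
  case (Cons e p)
  then obtain f r where q: "q = f # r" by (cases q) auto
  have e: "e \<in> arcs E" "u = tail E e" "awalk (head E e) p v" "f \<in> arcs E" "u = tail E f" "awalk (head E f) r w"
    using Cons.prems by (auto simp: q awalk_Cons_iff)
  have "tpath u (e # p) * d * spath u q \<doteq>
      (tpath (head E e) p * T e) * d * (S f * spath (head E f) r)"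
    unfolding q by (intro lcong_mult lcong_refl) (use e tpath_Cons spath_Cons in metis)+
  also have "\<dots> = tpath (head E e) p * (T e * d * S f) * spath (head E f) r"
    by (simp add: mult.assoc)
  also have "\<dots> \<doteq> 0"
  proof (cases "e = f")
    case True
    then have "p \<parallel> r"
      using Cons.prems(3) by (simp add: q parallel_def)
    with True show ?thesis
      using Cons.prems e by (auto simp: q intro!: Cons.IH T_diag_S)
  next
    case False
    then show ?thesis
      using Cons.prems e by (intro lcong_mult_zero(3) T_diag_S_zero) auto
  qed
  finally show ?case .
qed auto

lemma tpath_diag_spath_neq:
  assumes "u \<noteq> w" "d \<in> diag"
  shows "tpath u p * d * spath w q \<doteq> 0"
  using lcong_mult_zero(3) [OF P_diag_P_zero [OF assms(2,1)]]
  by (simp add: tpath_def spath_def mult.assoc)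

section \<open>Partitions of unity by paths of fixed length\<close>

definition npaths :: "nat \<Rightarrow> ('v \<times> 'e list) set" where
  "npaths n = {(u, p). (\<exists>v. awalk u p v) \<and> length p = n}"

lemma finite_npaths: "finite (npaths n)"
proof (rule finite_subset)
  show "npaths n \<subseteq> verts E \<times> {p. set p \<subseteq> arcs E \<and> length p = n}"
    by (auto simp: npaths_def awalk_def)
qed (simp add: finite_lists_length_eq)

text \<open>Each \<open>P v\<close> is split by its relation into the terms
  \<open>S e * T e\<close>, and the partition for \<open>n\<close> is inserted between the two
  factors; only walks from \<open>head E e\<close> survive.\<close>

lemma sum_proj: "(\<Sum>(u, p)\<in>npaths n. proj u p) \<doteq> 1"
proof (induction n)
  case 0
  have "(\<Sum>(u, p)\<in>npaths 0. proj u p) = (\<Sum>v\<in>verts E. proj v [])"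
    by (rule sum.reindex_bij_witness [of _ "\<lambda>v. (v, [])" fst])
      (auto simp: npaths_def awalk_Nil_iff)
  also have "\<dots> \<doteq> (\<Sum>v\<in>verts E. P v)"
    by (intro lcong_sum proj_Nil)
  also have "\<dots> \<doteq> 1" by (rule lcong_sym [OF one_sum])
  finally show ?case .
next
  case (Suc n)
  have "1 \<doteq> (\<Sum>v\<in>verts E. P v)" by (rule one_sum)
  also have "\<dots> \<doteq> (\<Sum>v\<in>verts E. \<Sum>e\<in>out_arcs E v. S e * T e)"
    by (intro lcong_sum P_sum)
  also have "\<dots> = (\<Sum>e\<in>arcs E. S e * T e)"
    using sum.group [of "arcs E" "verts E" "tail E" "\<lambda>e. S e * T e"]
    by (simp add: out_arcs_def image_subset_iff)
  also have "\<dots> \<doteq> (\<Sum>e\<in>arcs E. S e * (\<Sum>(u, p)\<in>npaths n. proj u p) * T e)"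
  proof (rule lcong_sum)
    fix e
    show "S e * T e \<doteq> S e * (\<Sum>(u, p)\<in>npaths n. proj u p) * T e"
      using lcong_sandwich [OF lcong_sym [OF Suc.IH], of "S e" "T e"] by simp
  qed
  also have "\<dots> = (\<Sum>e\<in>arcs E. \<Sum>(u, p)\<in>npaths n. S e * proj u p * T e)"
    by (simp add: sum_distrib_left sum_distrib_right case_prod_unfold)
  also have "\<dots> \<doteq> (\<Sum>e\<in>arcs E. \<Sum>(u, p)\<in>npaths n. if u = head E e then proj (tail E e) (e # p) else 0)"
    by (intro lcong_sum) (auto intro: S_proj_T)
  also have "\<dots> = (\<Sum>(e, x)\<in>arcs E \<times> npaths n. if fst x = head E e then proj (tail E e) (e # snd x) else 0)"
    by (simp add: sum.cartesian_product case_prod_unfold)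
  also have "\<dots> = (\<Sum>(e, x)\<in>{(e, x)\<in>arcs E \<times> npaths n. fst x = head E e}. proj (tail E e) (e # snd x))"
    by (intro sum.mono_neutral_cong_right) (auto simp: finite_npaths split: if_splits)
  also have "\<dots> = (\<Sum>(u, p)\<in>npaths (Suc n). proj u p)"
    by (rule sum.reindex_bij_witness
          [of _ "\<lambda>(u, p). (hd p, (head E (hd p), tl p))" "\<lambda>(e, x). (tail E e, e # snd x)"])
      (auto simp: npaths_def awalk_Cons_iff length_Suc_conv)
  finally show ?case by (rule lcong_sym)
qed

lemma one_diag: "1 \<in> diag"
proof (rule diag.lcong [OF _ lcong_sym [OF sum_proj [of 0]]])
  show "(\<Sum>(u, p)\<in>npaths 0. proj u p) \<in> diag"
    by (intro diag_sum) (auto simp: npaths_def intro: diag.path)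
qed

lemma tpath_spath_parallel:
  "awalk u p v \<Longrightarrow> awalk u q w \<Longrightarrow> p \<parallel> q \<Longrightarrow> tpath u p * spath u q \<doteq> 0"
  using tpath_diag_spath_parallel [OF _ _ _ one_diag, of u p v q w] by simp

lemma tpath_spath_neq: "u \<noteq> w \<Longrightarrow> tpath u p * spath w q \<doteq> 0"
  using tpath_diag_spath_neq [OF _ one_diag, of u w p q] by simp

lemma npaths_parallel:
  assumes "(u, p) \<in> npaths n" "(u, q) \<in> npaths n" "p \<noteq> q"
  shows "p \<parallel> q"
proof -
  have "length p = length q" using assms by (auto simp: npaths_def)
  with assms(3) show ?thesis by (auto simp: parallel_def prefix_def)
qed

text \<open>A walk at least as long as \<open>q\<close> extends \<open>q\<close> or is orthogonal to
  it, so \<open>c\<close> is \<open>1\<close> or \<open>0\<close>.\<close>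

lemma tpath_proj_spath:
  assumes p: "awalk u p v" and q: "awalk w q z" and len: "length q \<le> length p"
  obtains c where "tpath u p * proj w q * spath u p \<doteq> of_int c * P v"
proof -
  have eq: "tpath u p * proj w q * spath u p = (tpath u p * spath w q) * (tpath w q * spath u p)"
    by (simp add: proj_def mult.assoc)
  show thesis
  proof (cases "u = w \<and> prefix q p")
    case True
    then obtain r where r: "p = q @ r" by (auto simp: prefix_def)
    have zr: "awalk z r v" using p q True r by auto
    have "(tpath u p * spath w q) * (tpath w q * spath u p) \<doteq> tpath z r * spath z r"
      using p q True r by (intro lcong_mult) (auto intro: tpath_append_spath tpath_spath_append)
    also have "\<dots> \<doteq> of_int 1 * P v"
      using tpath_spath_same [OF zr] by simp
    finally show thesis unfolding eq [symmetric] by (rule that)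
  next
    case False
    then have "u \<noteq> w \<or> u = w \<and> p \<parallel> q"
      using len by (auto simp: parallel_def prefix_def)
    then have "tpath u p * spath w q \<doteq> 0"
      using p q tpath_spath_neq tpath_spath_parallel by blast
    from lcong_mult_zero(2) [OF this] show thesis
      using that [of 0] by (simp add: eq)
  qed
qed

text \<open>\<open>n\<close> bounds the lengths of the finitely many path projections from which
  \<open>d\<close> is built.\<close>

lemma tpath_diag_spath_scalar:
  assumes "d \<in> diag"
  obtains n where "\<And>u p v. awalk u p v \<Longrightarrow> length p \<ge> n \<Longrightarrow>
    \<exists>c. tpath u p * d * spath u p \<doteq> of_int c * P v"
proof -
  have "\<exists>n. \<forall>u p v. awalk u p v \<longrightarrow> length p \<ge> n \<longrightarrow>
    (\<exists>c. tpath u p * d * spath u p \<doteq> of_int c * P v)"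
    using assms
  proof induction
    case zero
    have "tpath u p * 0 * spath u p \<doteq> of_int 0 * P v" for u p v by simp
    then show ?case by blast
  next
    case (path w q z)
    have "\<exists>c. tpath u p * proj w q * spath u p \<doteq> of_int c * P v"
      if p: "awalk u p v" "length q \<le> length p" for u p v
      by (rule tpath_proj_spath [OF p(1) path p(2)]) blast
    then show ?case by blast
  next
    case (diff d d')
    then obtain n n' where n: "\<And>u p v. awalk u p v \<Longrightarrow> length p \<ge> n \<Longrightarrow>
        \<exists>c. tpath u p * d * spath u p \<doteq> of_int c * P v"
      and n': "\<And>u p v. awalk u p v \<Longrightarrow> length p \<ge> n' \<Longrightarrow>
        \<exists>c. tpath u p * d' * spath u p \<doteq> of_int c * P v" by metis
    have "\<exists>c. tpath u p * (d - d') * spath u p \<doteq> of_int c * P v"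
      if uv: "awalk u p v" "length p \<ge> max n n'" for u p v
    proof -
      obtain c where c: "tpath u p * d * spath u p \<doteq> of_int c * P v"
        using n [OF uv(1)] uv(2) by auto
      obtain c' where c': "tpath u p * d' * spath u p \<doteq> of_int c' * P v"
        using n' [OF uv(1)] uv(2) by auto
      from lcong_diff [OF c c'] have "tpath u p * (d - d') * spath u p \<doteq> of_int (c - c') * P v"
        by (simp add: algebra_simps)
      then show ?thesis by blast
    qed
    then show ?case by blast
  next
    case (lcong d d')
    then obtain n where n: "\<And>u p v. awalk u p v \<Longrightarrow> length p \<ge> n \<Longrightarrow>
        \<exists>c. tpath u p * d * spath u p \<doteq> of_int c * P v"
      by metis
    have "\<exists>c. tpath u p * d' * spath u p \<doteq> of_int c * P v"
      if uv: "awalk u p v" "length p \<ge> n" for u p v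
    proof -
      obtain c where "tpath u p * d * spath u p \<doteq> of_int c * P v"
        using n [OF uv] by blast
      with lcong_sandwich [OF lcong.hyps(2)] have "tpath u p * d' * spath u p \<doteq> of_int c * P v"
        by (rule lcong_trans)
      then show ?thesis by blast
    qed
    then show ?case by blast
  qed
  then show thesis using that by blast
qed

text \<open>The partition of unity is inserted on both sides of \<open>d\<close>. Off-diagonal
  corners vanish for every diagonal element, the others by hypothesis.\<close>

lemma diag_zero_if_compressions_zero:
  assumes d: "d \<in> diag" and zero: "\<And>u p. (u, p) \<in> npaths n \<Longrightarrow> tpath u p * d * spath u p \<doteq> 0"
  shows "d \<doteq> 0"
proof -
  have corner: "proj u p * d * proj w q \<doteq> 0" if "(u, p) \<in> npaths n" "(w, q) \<in> npaths n" for u p w q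
  proof -
    have "tpath u p * d * spath w q \<doteq> 0"
    proof (cases "u = w")
      case True
      show ?thesis
      proof (cases "p = q")
        case False
        then show ?thesis
          using npaths_parallel [of u p n q] True that tpath_diag_spath_parallel [OF _ _ _ d]
          by (auto simp: npaths_def)
      qed (use True zero that in simp)
    qed (rule tpath_diag_spath_neq [OF _ d])
    then have "spath u p * (tpath u p * d * spath w q) * tpath w q \<doteq> 0"
      by (rule lcong_mult_zero)
    then show ?thesis by (simp add: proj_def mult.assoc)
  qed
  have "d = 1 * d * 1" by simp
  also have "\<dots> \<doteq> (\<Sum>(u, p)\<in>npaths n. proj u p) * d * (\<Sum>(u, p)\<in>npaths n. proj u p)"
    by (intro lcong_mult lcong_sym [OF sum_proj] lcong_refl)
  also have "\<dots> = (\<Sum>(u, p)\<in>npaths n. \<Sum>(w, q)\<in>npaths n. proj u p * d * proj w q)"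
    by (simp add: case_prod_unfold sum_distrib_right sum_distrib_left) (rule sum.swap)
  also have "\<dots> \<doteq> 0"
    by (intro lcong_sum_zero) (auto intro!: lcong_sum_zero corner)
  finally show ?thesis .
qed

text \<open>Once \<open>t\<close> is as long as \<open>q\<close> it either begins with
  \<open>q\<close> or diverges from it, with no third case. Surjectivity rests on this, which is why
  \<open>tau\<close> has to grow.\<close>

lemma proj_spath:
  assumes "awalk w q z" "awalk u t v" "length q \<le> length t"
  shows "proj w q * spath u t \<doteq> (if w = u \<and> take (length q) t = q then spath u t else 0)"
proof (cases "w = u \<and> take (length q) t = q")
  case True
  then obtain r where r: "t = q @ r" by (metis append_take_drop_id)
  have "proj w q * spath u t = spath w q * (tpath w q * spath u t)"
    by (simp add: proj_def mult.assoc)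
  also have "\<dots> \<doteq> spath w q * spath z r"
    using assms True r by (intro lcong_mult lcong_refl) (auto intro: tpath_spath_append)
  also have "spath u (q @ r) \<doteq> spath u q * spath z r"
    using assms True r by (intro spath_append) auto
  then have "spath w q * spath z r \<doteq> spath u t"
    using True r lcong_sym by simp
  finally show ?thesis using True by simp
next
  case False
  then have "w \<noteq> u \<or> w = u \<and> q \<parallel> t"
    using assms(3) by (auto simp: parallel_def prefix_def)
  then have "tpath w q * spath u t \<doteq> 0"
    using assms tpath_spath_neq tpath_spath_parallel by blast
  then have "proj w q * spath u t \<doteq> 0"
    using lcong_mult_zero(1) [of "tpath w q * spath u t" "spath w q"]
    by (simp add: proj_def mult.assoc)
  then show ?thesis unfolding if_not_P [OF False] .
qed

section \<open>A representation on infinite paths\<close>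

lemma S_path_eq:
  assumes "(u, p) \<in> paths E"
  shows "S_path E (u, p) = qt (spath u p)"
proof -
  from assms have u: "u \<in> verts E" and arcs: "set p \<subseteq> arcs E" and tail: "p \<noteq> [] \<Longrightarrow> u = tail E (hd p)"
    by (auto simp: paths_def awalk_def cas_simp)
  have "foldr (mult (leavitt E)) (map (S_edge E) p) \<one>\<^bsub>leavitt E\<^esub> = qt (prod_list (map S p))"
    using arcs by (induction p) (simp_all add: qt_hom S_edge_def leavitt_gen_eq generators_def)
  moreover have "prod_list (map S p) \<doteq> spath u p" if "p \<noteq> []"
  proof (cases p)
    case (Cons e q)
    then have "P u * S e \<doteq> S e" using tail arcs P_S by simp
    from lcong_mult [OF lcong_sym [OF this] lcong_refl] show ?thesis
      by (simp add: Cons spath_def mult.assoc)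
  qed (use that in simp)
  ultimately show ?thesis
    using u by (auto simp: S_path_def P_vertex_def leavitt_gen_eq generators_def qt_eq_iff)
qed

lemma P_path_eq: "(u, p) \<in> paths E \<Longrightarrow> P_path E (u, p) = qt (proj u p)"
  by (simp add: P_path_def S_path_eq leavitt_star_qt proj_def qt_hom)

lemma diagonal_eq: "diagonal E = qt ` diag"
proof -
  interpret L: ring "leavitt E" by (rule ring_L)
  have "X \<in> qt ` diag" if "X \<in> diagonal E" for X
    using that unfolding diagonal_def
  proof induction
    case one
    show ?case using diag.zero qt_zero by force
  next
    case (incl h)
    then obtain u p where "(u, p) \<in> paths E" "h = qt (proj u p)"
      by (auto simp: P_path_eq)
    then show ?case by (auto simp: paths_def intro: diag.path)
  next
    case (inv h)
    then obtain u p where "(u, p) \<in> paths E" "h = qt (proj u p)"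
      by (auto simp: P_path_eq)
    then show ?case
      unfolding a_inv_def [symmetric]
      by (auto simp: qt_uminus paths_def intro!: diag_uminus diag.path)
  next
    case (eng h1 h2)
    then show ?case by (auto simp flip: qt_hom(1) intro: diag_add)
  qed
  moreover have "qt d \<in> diagonal E" if "d \<in> diag" for d
    using that
  proof induction
    case zero
    show ?case unfolding diagonal_def qt_zero using generate.one [of "add_monoid (leavitt E)"] by simp
  next
    case (path u p v)
    then have "(u, p) \<in> paths E" by (auto simp: paths_def)
    then show ?case
      unfolding diagonal_def by (auto simp flip: P_path_eq intro!: generate.incl)
  next
    case (diff d d')
    have "\<ominus>\<^bsub>leavitt E\<^esub> qt d' \<in> diagonal E"
      unfolding diagonal_def
      using diff by (intro L.add.generate_m_inv_closed) (auto simp: diagonal_def P_path_eq qt_hom)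
    then have "qt (- d') \<in> diagonal E"
      by (simp add: qt_uminus)
    then have "qt d \<oplus>\<^bsub>leavitt E\<^esub> qt (- d') \<in> diagonal E"
      using diff generate.eng [of "qt d" "add_monoid (leavitt E)" _ "qt (- d')"] by (simp add: diagonal_def)
    then show ?case by (simp flip: qt_hom(1))
  next
    case (lcong d d')
    then show ?case using qt_eq_iff by metis
  qed
  ultimately show ?thesis by blast
qed

text \<open>
  An action on functions of infinite paths, meaningful only at points of \<open>ipaths\<close>. The factors
  \<open>2\<close> and \<open>1/2\<close> record the degree: \<open>S\<^sub>\<alpha>\<close> scales by \<open>2\<^sup>|\<^sup>\<alpha>\<^sup>|\<close>.
\<close>

fun rep :: "('v,'e) generator \<Rightarrow> ('e stream \<Rightarrow> real) \<Rightarrow> 'e stream \<Rightarrow> real" where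
  "rep (Vertex v) f x = (if tail E (shd x) = v then f x else 0)"
| "rep (Edge e) f x = (if shd x = e then 2 * f (stl x) else 0)"
| "rep (Ghost e) f x = (if e \<in> arcs E \<and> head E e = tail E (shd x) then f (e ## x) / 2 else 0)"

definition ipaths :: "'e stream set" where
  "ipaths = {x. \<forall>n. x !! n \<in> arcs E \<and> head E (x !! n) = tail E (x !! Suc n)}"

abbreviation act :: "('v,'e) free_elem \<Rightarrow> ('e stream \<Rightarrow> real) \<Rightarrow> 'e stream \<Rightarrow> real" where
  "act \<equiv> free_act rep"

lemma ipaths_SCons: "e ## x \<in> ipaths \<longleftrightarrow> e \<in> arcs E \<and> head E e = tail E (shd x) \<and> x \<in> ipaths"
proof
  assume *: "e ## x \<in> ipaths"
  have "x !! n \<in> arcs E \<and> head E (x !! n) = tail E (x !! Suc n)" for n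
    using * unfolding ipaths_def by (auto dest: spec [of _ "Suc n"])
  moreover have "e \<in> arcs E \<and> head E e = tail E (shd x)"
    using * unfolding ipaths_def by (auto dest: spec [of _ 0])
  ultimately show "e \<in> arcs E \<and> head E e = tail E (shd x) \<and> x \<in> ipaths"
    by (simp add: ipaths_def)
next
  assume *: "e \<in> arcs E \<and> head E e = tail E (shd x) \<and> x \<in> ipaths"
  have "(e ## x) !! n \<in> arcs E \<and> head E ((e ## x) !! n) = tail E ((e ## x) !! Suc n)" for n
    using * by (cases n) (auto simp: ipaths_def)
  then show "e ## x \<in> ipaths" by (simp add: ipaths_def)
qed

lemma ipaths_stl: "x \<in> ipaths \<Longrightarrow> stl x \<in> ipaths"
  using ipaths_SCons [of "shd x" "stl x"] by simp

lemma ipaths_sdrop: "x \<in> ipaths \<Longrightarrow> sdrop n x \<in> ipaths"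
  by (induction n arbitrary: x) (simp_all add: ipaths_stl)

lemma ipaths_shd: "x \<in> ipaths \<Longrightarrow> shd x \<in> arcs E" "x \<in> ipaths \<Longrightarrow> head E (shd x) = tail E (shd (stl x))"
  using ipaths_SCons [of "shd x" "stl x"] by simp_all

lemma rep_diff: "rep g (f - f') = rep g f - rep g f'"
  by (rule ext, cases g) (simp_all add: diff_divide_distrib)

lemmas act_mult = free_act_mult [of rep, OF rep_diff]

lemma act_zero: "act p 0 = 0"
  using free_act_diff_right [of rep p 0 0, OF rep_diff] by simp

text \<open>Generators read a function at points of \<open>ipaths\<close> only, when evaluated
  there. Hence values elsewhere, where the relations may fail, never enter.\<close>

lemma act_cong:
  assumes "\<And>x. x \<in> ipaths \<Longrightarrow> f x = f' x" "x \<in> ipaths"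
  shows "act p f x = act p f' x"
  using assms
proof (induction p arbitrary: f f' x rule: free_induct)
  case (gen g)
  then show ?case by (cases g) (auto simp: ipaths_stl ipaths_SCons)
next
  case (mult p q)
  show ?case
    unfolding act_mult using mult.prems by (intro mult.IH) auto
next
  case (diff p q)
  show ?case
    using diff.IH(1) [OF diff.prems] diff.IH(2) [OF diff.prems] by (simp add: free_act_diff)
qed simp_all

text \<open>On \<open>ipaths\<close> a generator outside the graph acts as zero: the first edge and
  its tail lie in the graph, and the clause of \<open>rep\<close> for ghosts tests
  membership.\<close>

lemma act_restr: "x \<in> ipaths \<Longrightarrow> act (restr p) f x = act p f x"
proof (induction p arbitrary: f x rule: free_induct)
  case (gen g)
  then show ?case
    by (cases g) (auto simp: generators_def ipaths_shd)
next
  case (mult p q)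
  have "act (restr p) (act (restr q) f) x = act (restr p) (act q f) x"
    using mult by (intro act_cong) auto
  then show ?case using mult by (simp add: act_mult)
qed (auto simp: free_act_diff)

text \<open>Every relation is homogeneous in degree, so the factors 2 and 1/2 cancel, and what
  remains are identities between removing and prefixing a first edge.\<close>

lemma act_ideal:
  assumes "p \<in> leavitt_ideal E" "x \<in> ipaths"
  shows "act p f x = 0"
proof -
  let ?K = "{p \<in> carrier (free_ring E). \<forall>f. \<forall>x\<in>ipaths. act p f x = 0}"
  have "leavitt_ideal E \<subseteq> ?K"
  proof (rule leavitt_ideal_subset)
    show "leavitt_relations E \<subseteq> ?K"
    proof
      fix r assume r: "r \<in> leavitt_relations E"
      then have "r \<in> carrier (free_ring E)"
        by (intro leavitt_ideal_closed)
      moreover have "act r f x = 0" if "x \<in> ipaths" for f x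
        using r that
      proof cases
        case (vertex_sum v)
        \<comment> \<open>An infinite path has exactly one first edge, so at most one summand is
          nonzero.\<close>
        have "act (\<Sum>e\<in>out_arcs E v. S e * T e) f x = (\<Sum>e\<in>out_arcs E v. if e = shd x then f x else 0)"
          unfolding free_act_sum sum_fun_apply
        proof (rule sum.cong)
          fix e assume "e \<in> out_arcs E v"
          then show "act (S e * T e) f x = (if e = shd x then f x else 0)"
            using ipaths_shd [OF that] by (auto simp: act_mult)
        qed simp
        also have "\<dots> = (if tail E (shd x) = v then f x else 0)"
          using ipaths_shd [OF that] by (simp add: sum.delta' out_arcs_def)
        finally show ?thesis
          by (simp add: vertex_sum free_act_diff)
      next
        case unit_sum
        then show ?thesis using ipaths_shd [OF that]
          by (simp add: free_act_diff free_act_sum sum_fun_apply)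
      qed (auto simp: free_act_diff act_mult ipaths_shd)
      ultimately show "r \<in> ?K" by simp
    qed
  next
    fix a p assume *: "a \<in> carrier (free_ring E)" "p \<in> ?K"
    have "act a (act p f) x = act a 0 x" if "x \<in> ipaths" for f x
      using * that by (intro act_cong) auto
    with * show "a * p \<in> ?K" "p * a \<in> ?K"
      by (auto simp: act_mult act_zero free_ring_closed)
  qed (auto simp: free_act_diff free_ring_closed)
  then show ?thesis using assms by auto
qed

lemma act_lcong:
  assumes "p \<doteq> q" "x \<in> ipaths"
  shows "act p f x = act q f x"
proof -
  have "act (p - q) f x = act (restr (p - q)) f x"
    using assms(2) by (rule act_restr [symmetric])
  also have "\<dots> = 0"
    using assms unfolding lcong_def by (rule act_ideal)
  finally show ?thesis by (simp add: free_act_diff)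
qed

lemma act_spath: "act (spath u p) f x =
  (if u = tail E (shd x) \<and> stake (length p) x = p then 2 ^ length p * f (sdrop (length p) x) else 0)"
proof -
  have "act (prod_list (map S p)) f x =
    (if stake (length p) x = p then 2 ^ length p * f (sdrop (length p) x) else 0)"
  proof (induction p arbitrary: x)
    case (Cons e p)
    show ?case by (simp add: act_mult Cons.IH)
  qed simp
  then show ?thesis by (simp add: spath_def act_mult)
qed

lemma awalk_shift:
  assumes "awalk u p v" "x \<in> ipaths" "v = tail E (shd x)"
  shows "p @- x \<in> ipaths" "tail E (shd (p @- x)) = u"
proof -
  have "p @- x \<in> ipaths \<and> tail E (shd (p @- x)) = u"
    using assms
  proof (induction p arbitrary: u)
    case (Cons e p)
    then have "p @- x \<in> ipaths \<and> tail E (shd (p @- x)) = head E e"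
      by (intro Cons.IH) (auto simp: awalk_Cons_iff)
    with Cons.prems show ?case by (auto simp: ipaths_SCons awalk_Cons_iff)
  qed (auto simp: awalk_Nil_iff)
  then show "p @- x \<in> ipaths" "tail E (shd (p @- x)) = u" by simp_all
qed

lemma act_tpath:
  assumes "awalk u p v" "x \<in> ipaths"
  shows "act (tpath u p) f x = (if v = tail E (shd x) then f (p @- x) / 2 ^ length p else 0)"
  using assms
proof (induction p arbitrary: u f)
  case Nil
  then show ?case by (auto simp: awalk_Nil_iff)
next
  case (Cons e p)
  then have e: "e \<in> arcs E" "u = tail E e" "awalk (head E e) p v"
    by (auto simp: awalk_Cons_iff)
  have "act (tpath u (e # p)) f x = act (tpath (head E e) p) (rep (Ghost e) f) x"
    using act_lcong [OF tpath_Cons [OF e(1)] Cons.prems(2)] e(2) by (simp add: act_mult)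
  also have "\<dots> = (if v = tail E (shd x) then rep (Ghost e) f (p @- x) / 2 ^ length p else 0)"
    by (rule Cons.IH) fact+
  finally show ?case
    using e awalk_shift(2) [OF e(3) Cons.prems(2)] by simp
qed

section \<open>Nonvanishing and degrees from the representation\<close>

lemma ex_ipath:
  assumes "no_sinks E" "v \<in> verts E"
  obtains x where "x \<in> ipaths" "tail E (shd x) = v"
proof -
  define f where "f w = (SOME e. e \<in> out_arcs E w)" for w
  have f: "f w \<in> out_arcs E w" if "w \<in> verts E" for w
    using assms(1) that unfolding f_def no_sinks_def by (metis some_in_eq)
  define x where "x = siterate (\<lambda>e. f (head E e)) (f v)"
  have Suc: "x !! Suc n = f (head E (x !! n))" for n
    by (simp only: x_def snth_siterate funpow.simps o_apply)
  have arcs: "x !! n \<in> arcs E" for n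
  proof (induction n)
    case 0
    show ?case using f [OF assms(2)] by (simp add: x_def)
  next
    case (Suc n)
    then show ?case using f [of "head E (x !! n)"] Suc by (simp only: \<open>x !! Suc n = _\<close>) simp
  qed
  have "x \<in> ipaths"
    using arcs f [OF head_in_verts [OF arcs]] by (simp add: ipaths_def Suc del: snth.simps)
  moreover have "tail E (shd x) = v"
    using f [OF assms(2)] by (simp add: x_def)
  ultimately show thesis by (rule that)
qed

text \<open>On the constant function \<open>1\<close>, at an infinite path that starts in
  \<open>v\<close>, the element takes the value \<open>c\<close>.\<close>

lemma of_int_P_zero:
  assumes "no_sinks E" "v \<in> verts E" "of_int c * P v \<doteq> 0"
  shows "c = 0"
proof -
  obtain x where x: "x \<in> ipaths" "tail E (shd x) = v"
    using assms(1,2) by (rule ex_ipath)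
  have "act (of_int c * P v) 1 x = 0"
    using act_lcong [OF assms(3) x(1)] by simp
  then show ?thesis using x by (simp add: act_mult)
qed

text \<open>At an infinite path beginning with \<open>g\<close>, the constant function
  \<open>1\<close> is scaled by \<open>2 ^ length g\<close>. On the other side
  \<open>spath u p\<close> gives \<open>2 ^ length p\<close> or \<open>0\<close>, and
  \<open>tpath u p\<close> gives the inverse power or \<open>0\<close>.\<close>

lemma spath_degree:
  assumes "no_sinks E" "awalk w g z"
  shows "awalk u p v \<Longrightarrow> spath w g \<doteq> spath u p \<Longrightarrow> length p = length g"
    and "awalk u p v \<Longrightarrow> spath w g \<doteq> tpath u p \<Longrightarrow> length g = 0 \<and> length p = 0"
proof -
  obtain y where y: "y \<in> ipaths" "tail E (shd y) = z"
    using assms(1) awalk_last_in_verts [OF assms(2)] by (rule ex_ipath)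
  let ?x = "g @- y"
  have x: "?x \<in> ipaths" "tail E (shd ?x) = w"
    using awalk_shift [OF assms(2) y(1)] y(2) by auto
  have 1: "act (spath w g) 1 ?x = 2 ^ length g"
    using x by (simp add: act_spath stake_shift sdrop_shift)
  show "length p = length g" if "awalk u p v" "spath w g \<doteq> spath u p"
    using act_lcong [OF that(2) x(1), of 1] unfolding 1 by (simp add: act_spath split: if_splits)
  show "length g = 0 \<and> length p = 0" if "awalk u p v" "spath w g \<doteq> tpath u p"
  proof -
    have "(2::real) ^ length g * 2 ^ length p = 1"
      using act_lcong [OF that(2) x(1), of 1]
      unfolding 1 by (simp add: act_tpath [OF that(1) x(1)] split: if_splits)
    then have "(2::real) ^ (length g + length p) = 1" by (simp add: power_add)
    then have "length g + length p = 0"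
      using one_less_power [of "2::real" "length g + length p"] by (cases "length g + length p") auto
    then show ?thesis by simp
  qed
qed

text \<open>Evaluating the \<open>THE\<close> needs uniqueness of the degree, which is
  \<open>spath_degree\<close>: a label that is both a path and an adjoint of a path has degree
  \<open>0\<close> in either reading.\<close>

lemma edge_degree_spath:
  assumes "no_sinks E" "awalk w g z" "coding_label E a = qt (spath w g)"
  shows "edge_degree E a = int (length g)"
  unfolding edge_degree_def
proof (rule the_equality)
  have "(w, g) \<in> paths E" using assms(2) by (auto simp: paths_def)
  then show "\<exists>\<alpha>\<in>paths E. coding_label E a = S_path E \<alpha> \<and> int (length g) = int (path_length \<alpha>) \<or>
      coding_label E a = leavitt_star (S_path E \<alpha>) \<and> int (length g) = - int (path_length \<alpha>)"
    using assms(3) S_path_eq [of w g] by (intro bexI [of _ "(w, g)"]) (auto simp: path_length_def)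
next
  fix d
  assume "\<exists>\<alpha>\<in>paths E. coding_label E a = S_path E \<alpha> \<and> d = int (path_length \<alpha>) \<or>
      coding_label E a = leavitt_star (S_path E \<alpha>) \<and> d = - int (path_length \<alpha>)"
  then obtain u p where up: "(u, p) \<in> paths E"
    and d: "qt (spath w g) = qt (spath u p) \<and> d = int (length p) \<or>
      qt (spath w g) = qt (tpath u p) \<and> d = - int (length p)"
    by (auto simp: assms(3) path_length_def S_path_eq leavitt_star_qt)
  obtain v where "awalk u p v" using up by (auto simp: paths_def)
  then show "d = int (length g)"
    using spath_degree [OF assms(1,2), of u p v] d by (auto simp: qt_eq_iff)
qed

lemma edge_degree_tpath:
  assumes "no_sinks E" "awalk w g z" "coding_label E a = qt (tpath w g)"
  shows "edge_degree E a = - int (length g)"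
  unfolding edge_degree_def
proof (rule the_equality)
  have "(w, g) \<in> paths E" using assms(2) by (auto simp: paths_def)
  then show "\<exists>\<alpha>\<in>paths E. coding_label E a = S_path E \<alpha> \<and> - int (length g) = int (path_length \<alpha>) \<or>
      coding_label E a = leavitt_star (S_path E \<alpha>) \<and> - int (length g) = - int (path_length \<alpha>)"
    using assms(3) S_path_eq [of w g]
    by (intro bexI [of _ "(w, g)"]) (auto simp: path_length_def leavitt_star_qt)
next
  fix d
  assume "\<exists>\<alpha>\<in>paths E. coding_label E a = S_path E \<alpha> \<and> d = int (path_length \<alpha>) \<or>
      coding_label E a = leavitt_star (S_path E \<alpha>) \<and> d = - int (path_length \<alpha>)"
  then obtain u p where up: "(u, p) \<in> paths E"
    and d: "tpath w g \<doteq> spath u p \<and> d = int (length p) \<or>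
      tpath w g \<doteq> tpath u p \<and> d = - int (length p)"
    by (auto simp: assms(3) path_length_def S_path_eq leavitt_star_qt qt_eq_iff)
  from d have "spath w g \<doteq> tpath u p \<and> d = int (length p) \<or>
      spath w g \<doteq> spath u p \<and> d = - int (length p)"
    using free_star_lcong [of "tpath w g" "spath u p"] free_star_lcong [of "tpath w g" "tpath u p"]
    by auto
  moreover obtain v where "awalk u p v" using up by (auto simp: paths_def)
  ultimately show "d = - int (length g)"
    using spath_degree [OF assms(1,2), of u p v] by auto
qed

end

section \<open>The endomorphism of an admissible set\<close>

locale admissible_pairs = leavitt_graph E for E :: "('v,'e) pre_digraph" +
  fixes J :: "('v,'e) coding_vertex set"
  assumes adm: "admissible E J"
begin

abbreviation src :: "('v,'e) coding_vertex \<Rightarrow> 'v" where "src j \<equiv> fst (fst j)"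
abbreviation mu :: "('v,'e) coding_vertex \<Rightarrow> 'e list" where "mu j \<equiv> snd (fst j)"
abbreviation kap :: "('v,'e) coding_vertex \<Rightarrow> 'e list" where "kap j \<equiv> snd (snd j)"

lemma finite_J: "finite J"
  using adm by (simp add: admissible_def)

lemma J_walkE:
  assumes "j \<in> J"
  obtains v where "awalk (src j) (mu j) v" "awalk (src j) (kap j) v" "kap j \<noteq> []" "fst (snd j) = src j"
proof -
  obtain u p w q where j: "j = ((u, p), (w, q))" by (metis prod.collapse)
  have "(u, p) \<in> paths E" "(w, q) \<in> paths E" "u = w" "awlast u p = awlast w q" "q \<noteq> []"
    using adm assms by (auto simp: admissible_def j path_source_def path_range_def path_length_def)
  then show thesis
    using that [of "awlast u p"] by (auto simp: paths_def j)
qed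

definition U :: "('v,'e) free_elem" where
  "U = (\<Sum>j\<in>J. spath (src j) (mu j) * tpath (src j) (kap j))"

abbreviation U' :: "('v,'e) free_elem" where "U' \<equiv> free_star U"

lemma U'_eq: "U' = (\<Sum>j\<in>J. spath (src j) (kap j) * tpath (src j) (mu j))"
  by (simp add: U_def free_star_sum free_star_mult)

lemma u_elem_eq: "u_elem E J = qt U"
proof -
  interpret L: ring "leavitt E" by (rule ring_L)
  have "(case j of (\<mu>, \<nu>) \<Rightarrow> S_path E \<mu> \<otimes>\<^bsub>leavitt E\<^esub> leavitt_star (S_path E \<nu>)) =
      qt (spath (src j) (mu j) * tpath (src j) (kap j))" if j: "j \<in> J" for j
  proof -
    obtain v where v: "awalk (src j) (mu j) v" "awalk (src j) (kap j) v" "fst (snd j) = src j"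
      using j by (rule J_walkE)
    then have "j = ((src j, mu j), (src j, kap j))"
      by (metis prod.collapse)
    moreover have "S_path E (src j, mu j) = qt (spath (src j) (mu j))"
      "S_path E (src j, kap j) = qt (spath (src j) (kap j))"
      using v by (auto intro!: S_path_eq simp del: prod.collapse simp: paths_def)
    ultimately show ?thesis
      by (metis (no_types, lifting) case_prod_conv leavitt_star_qt free_star_spath qt_hom(2))
  qed
  then show ?thesis
    unfolding u_elem_def U_def qt_sum [OF finite_J]
    by (intro L.finsum_cong') (auto simp: qt_hom(4))
qed

lemma U_unitary: "U' * U \<doteq> 1" "U * U' \<doteq> 1"
  using adm by (simp_all add: admissible_def is_unitary_def u_elem_eq leavitt_star_qt qt_eq_iff
      flip: qt_hom(2,3))

lemma U_cancel: "a * U' * (U * b) \<doteq> a * b" "a * U * (U' * b) \<doteq> a * b"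
  using lcong_sandwich [OF U_unitary(1), of a b] lcong_sandwich [OF U_unitary(2), of a b]
  by (simp_all add: mult.assoc)

text \<open>The two components of a pair have the same source.\<close>

lemma P_U: "P v * U \<doteq> U * P v"
proof -
  have "P v * U = (\<Sum>j\<in>J. (P v * spath (src j) (mu j)) * tpath (src j) (kap j))"
    by (simp add: U_def sum_distrib_left mult.assoc)
  also have "\<dots> \<doteq> (\<Sum>j\<in>J. (if v = src j then spath (src j) (mu j) else 0) * tpath (src j) (kap j))"
    by (intro lcong_sum lcong_mult P_spath lcong_refl)
  also have "\<dots> = (\<Sum>j\<in>J. spath (src j) (mu j) * (if v = src j then tpath (src j) (kap j) else 0))"
    by (intro sum.cong) auto
  also have "\<dots> \<doteq> (\<Sum>j\<in>J. spath (src j) (mu j) * (tpath (src j) (kap j) * P v))"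
    by (intro lcong_sum lcong_mult lcong_sym [OF tpath_P] lcong_refl)
  also have "\<dots> = U * P v"
    by (simp add: U_def sum_distrib_right mult.assoc)
  finally show ?thesis .
qed

lemma P_U': "P v * U' \<doteq> U' * P v"
  using free_star_lcong [OF P_U [of v]] by (auto simp: free_star_mult intro: lcong_sym)

lemma ex_awalk_mu: "j \<in> J \<Longrightarrow> \<exists>v. awalk (src j) (mu j) v"
  and ex_awalk_kap: "j \<in> J \<Longrightarrow> \<exists>v. awalk (src j) (kap j) v"
  by (blast elim: J_walkE)+

section \<open>Positivity and incomparable second components\<close>

lemma act_nonneg:
  assumes "awalk u p v" "\<And>x. x \<in> ipaths \<Longrightarrow> f x \<ge> 0" "x \<in> ipaths"
  shows "act (spath u q) f x \<ge> 0" "act (tpath u p) f x \<ge> 0"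
  using assms awalk_shift(1) [OF assms(1,3)] by (auto simp: act_spath act_tpath ipaths_sdrop)

text \<open>On a non-negative function every summand is non-negative, so dropping summands leaves a
  lower bound.\<close>

lemma sum_act:
  assumes f: "\<And>x. x \<in> ipaths \<Longrightarrow> f x \<ge> 0" and x: "x \<in> ipaths"
    and walks: "\<And>j. j \<in> J \<Longrightarrow> \<exists>v. awalk (src j) (b j) v"
    and K: "K \<subseteq> J"
  shows "act (\<Sum>j\<in>J. spath (src j) (a j) * tpath (src j) (b j)) f x \<ge>
    (\<Sum>j\<in>K. act (spath (src j) (a j)) (act (tpath (src j) (b j)) f) x)"
    and "act (\<Sum>j\<in>J. spath (src j) (a j) * tpath (src j) (b j)) f x \<ge> 0"
proof -
  have nonneg: "act (spath (src j) (a j)) (act (tpath (src j) (b j)) f) x \<ge> 0" if j: "j \<in> J" for j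
  proof -
    obtain v where v: "awalk (src j) (b j) v" using walks [OF j] by blast
    show ?thesis
      using act_nonneg [OF v] f x by blast
  qed
  have eq: "act (\<Sum>j\<in>J. spath (src j) (a j) * tpath (src j) (b j)) f x =
      (\<Sum>j\<in>J. act (spath (src j) (a j)) (act (tpath (src j) (b j)) f) x)"
    by (simp add: free_act_sum sum_fun_apply act_mult)
  show "act (\<Sum>j\<in>J. spath (src j) (a j) * tpath (src j) (b j)) f x \<ge>
    (\<Sum>j\<in>K. act (spath (src j) (a j)) (act (tpath (src j) (b j)) f) x)"
    unfolding eq using nonneg K finite_J by (intro sum_mono2) auto
  show "act (\<Sum>j\<in>J. spath (src j) (a j) * tpath (src j) (b j)) f x \<ge> 0"
    unfolding eq using nonneg by (intro sum_nonneg)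
qed

text \<open>
  Applied to the constant function \<open>1\<close>, the relation \<open>U\<^sup>*U = 1\<close> says that weights which are at least
  \<open>1\<close> for every pair whose second component is an initial segment of \<open>x\<close> sum to \<open>1\<close>.
\<close>

lemma kap_incomparable:
  assumes sinks: "no_sinks E" and "j \<in> J" "k \<in> J" "src j = src k" "\<not> kap j \<parallel> kap k"
  shows "j = k"
proof -
  have "j = k" if jk: "j \<in> J" "k \<in> J" "src j = src k" "prefix (kap j) (kap k)" for j k
  proof (rule ccontr)
    assume "j \<noteq> k"
    obtain v where v: "awalk (src j) (mu j) v" "awalk (src j) (kap j) v"
      using jk(1) by (rule J_walkE)
    obtain w where w: "awalk (src k) (mu k) w" "awalk (src k) (kap k) w"
      using jk(2) by (rule J_walkE)
    obtain y where y: "y \<in> ipaths" "tail E (shd y) = w"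
      using sinks awalk_last_in_verts [OF w(2)] by (rule ex_ipath)
    \<comment> \<open>As \<open>kap j\<close> is a prefix of \<open>kap k\<close>, this infinite
      path begins with both.\<close>
    define x where "x = kap k @- y"
    have x: "x \<in> ipaths" "tail E (shd x) = src k"
      using awalk_shift [OF w(2) y(1)] y(2) by (auto simp: x_def)
    have U1: "act U 1 z \<ge> 0" if "z \<in> ipaths" for z
      unfolding U_def using that by (intro sum_act(2) [of _ _ _ "{}"] ex_awalk_kap) auto
    let ?term = "\<lambda>i. act (spath (src i) (kap i)) (act (tpath (src i) (mu i)) (act U 1)) x"
    \<comment> \<open>The term replaces \<open>kap i\<close> by \<open>mu i\<close> at the front of
      \<open>x\<close> and then applies \<open>U\<close>, of which only the summand at
      \<open>i\<close> is kept; that summand reverses the replacement, so the powers of 2 cancel and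
      leave \<open>1\<close>.\<close>
    have ge: "?term i \<ge> 1"
      if i: "i \<in> J" "src i = src k" "kap i @- z = x" "awalk (src i) (mu i) a" "tail E (shd z) = a" "z \<in> ipaths" for i z a
    proof -
      have z: "sdrop (length (kap i)) x = z" "stake (length (kap i)) x = kap i"
        by (simp_all flip: i(3) add: sdrop_shift stake_shift)
      have m: "mu i @- z \<in> ipaths" "tail E (shd (mu i @- z)) = src i"
        using awalk_shift [OF i(4,6)] i(5) by auto
      have "act U 1 (mu i @- z) \<ge>
          (\<Sum>j\<in>{i}. act (spath (src j) (mu j)) (act (tpath (src j) (kap j)) 1) (mu i @- z))"
        unfolding U_def using i m by (intro sum_act(1) ex_awalk_kap) auto
      moreover obtain a' where "awalk (src i) (mu i) a'" "awalk (src i) (kap i) a'"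
        using i(1) by (rule J_walkE)
      then have "awalk (src i) (kap i) a"
        using i(4) by auto
      ultimately have "act U 1 (mu i @- z) \<ge> 2 ^ length (mu i) / 2 ^ length (kap i)"
        using m i by (simp add: act_spath sdrop_shift stake_shift act_tpath)
      moreover have "act (tpath (src i) (mu i)) (act U 1) z = act U 1 (mu i @- z) / 2 ^ length (mu i)"
        by (simp add: act_tpath [OF i(4,6)] i(5))
      then have "?term i = 2 ^ length (kap i) * (act U 1 (mu i @- z) / 2 ^ length (mu i))"
        by (simp add: act_spath z x(2) i(2))
      moreover have "2 ^ length (kap i) * (b / 2 ^ length (mu i)) \<ge> 1"
        if "b \<ge> 2 ^ length (mu i) / 2 ^ length (kap i)" for b :: real
        using that by (simp add: field_simps)
      ultimately show ?thesis
        by simp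
    qed
    obtain r where r: "kap k = kap j @ r" using jk(4) by (auto simp: prefix_def)
    have "awalk (src j) (kap j @ r) w" using w r jk(3) by simp
    then have rw: "awalk v r w"
      using v(2) by auto
    have "?term j \<ge> 1"
      using jk v awalk_shift [OF rw y(1)] y r by (intro ge [of j "r @- y" v]) (auto simp: x_def)
    moreover have "?term k \<ge> 1"
      using jk w y by (intro ge [of k y w]) (auto simp: x_def)
    ultimately have "2 \<le> (\<Sum>i\<in>{j, k}. ?term i)"
      using \<open>j \<noteq> k\<close> by simp
    also have "\<dots> \<le> act U' (act U 1) x"
      unfolding U'_eq using jk U1 x by (intro sum_act(1) ex_awalk_mu) auto
    also have "\<dots> = act (U' * U) 1 x" by (simp add: act_mult)
    also have "\<dots> = 1"
      using act_lcong [OF U_unitary(1) x(1), of 1] by simp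
    finally show False by simp
  qed
  from this [of j k] this [of k j] assms show ?thesis by auto
qed

section \<open>The endomorphism on representatives\<close>

text \<open>\<open>Lambda\<close> on the level of the free ring; the value on ghosts is forced by
  compatibility with the adjoint.\<close>

definition phi :: "('v,'e) free_elem \<Rightarrow> ('v,'e) free_elem" where
  "phi = free_lift (\<lambda>g. case g of Vertex v \<Rightarrow> P v | Edge e \<Rightarrow> U * S e | Ghost e \<Rightarrow> T e * U')"

lemma phi_simps [simp]:
  "phi 0 = 0" "phi 1 = 1" "phi (P v) = P v" "phi (S e) = U * S e" "phi (T e) = T e * U'"
  "phi (p + q) = phi p + phi q" "phi (p - q) = phi p - phi q" "phi (p * q) = phi p * phi q"
  "phi (sum f A) = (\<Sum>a\<in>A. phi (f a))" "phi (of_int k) = of_int k"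
  by (simp_all add: phi_def free_lift_add free_lift_diff free_lift_mult free_lift_sum)

lemma phi_star: "phi (free_star p) = free_star (phi p)"
proof (induction p rule: free_induct)
  case (gen g)
  show ?case by (cases g) (simp_all add: free_star_mult)
qed (simp_all add: free_star_diff free_star_mult)

text \<open>The relations between ghosts and edges use \<open>U' * U \<doteq> 1\<close>, the vertex
  sums use \<open>U * U' \<doteq> 1\<close>, and those involving the source of an edge use that
  \<open>U\<close> commutes with vertex projections.\<close>

lemma phi_lcong:
  assumes "p \<doteq> q" shows "phi p \<doteq> phi q"
proof (rule lcong_hom [OF _ _ _ _ _ assms])
  fix r assume "r \<in> leavitt_relations E"
  then show "phi r \<doteq> 0"
  proof cases
    case (idempotent v)
    then show ?thesis using P_mult [of v v] by (simp flip: lcong_zero_iff)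
  next
    case (orthogonal v w)
    then show ?thesis using P_mult [of v w] by simp
  next
    case (ghost_edge_distinct e f)
    then show ?thesis
      using lcong_trans [OF U_cancel(1) T_S, of e f] by simp
  next
    case (ghost_edge e)
    then show ?thesis
      using lcong_trans [OF U_cancel(1) T_S, of e e] by (simp flip: lcong_zero_iff)
  next
    case (source_edge e)
    have "P (tail E e) * (U * S e) = P (tail E e) * U * S e"
      by (simp add: mult.assoc)
    also have "\<dots> \<doteq> U * P (tail E e) * S e"
      by (intro lcong_mult P_U lcong_refl)
    also have "\<dots> = U * (P (tail E e) * S e)"
      by (simp add: mult.assoc)
    also have "\<dots> \<doteq> U * S e"
      using source_edge by (intro lcong_mult P_S lcong_refl)
    finally show ?thesis using source_edge by (simp flip: lcong_zero_iff)
  next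
    case (edge_range e)
    then show ?thesis
      using lcong_mult [OF lcong_refl S_P, of e U] by (simp add: mult.assoc flip: lcong_zero_iff)
  next
    case (ghost_source e)
    have "T e * U' * P (tail E e) = T e * (U' * P (tail E e))"
      by (simp add: mult.assoc)
    also have "\<dots> \<doteq> T e * (P (tail E e) * U')"
      by (intro lcong_mult lcong_sym [OF P_U'] lcong_refl)
    also have "\<dots> = T e * P (tail E e) * U'"
      by (simp add: mult.assoc)
    also have "\<dots> \<doteq> T e * U'"
      using ghost_source by (intro lcong_mult T_P lcong_refl)
    finally show ?thesis using ghost_source by (simp flip: lcong_zero_iff)
  next
    case (range_ghost e)
    then show ?thesis
      using lcong_mult [OF P_T lcong_refl, of e U'] by (simp add: mult.assoc flip: lcong_zero_iff)
  next
    case (vertex_sum v)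
    have "(\<Sum>e\<in>out_arcs E v. U * S e * (T e * U')) = U * (\<Sum>e\<in>out_arcs E v. S e * T e) * U'"
      by (simp add: sum_distrib_left sum_distrib_right mult.assoc)
    also have "\<dots> \<doteq> U * P v * U'"
      using vertex_sum by (intro lcong_sandwich lcong_sym [OF P_sum])
    also have "\<dots> \<doteq> P v * U * U'"
      by (intro lcong_mult lcong_sym [OF P_U] lcong_refl)
    also have "\<dots> \<doteq> P v"
      using U_cancel(2) [of "P v" 1] by simp
    finally show ?thesis
      using vertex_sum lcong_sym by (simp flip: lcong_zero_iff)
  next
    case unit_sum
    then show ?thesis using one_sum by (simp flip: lcong_zero_iff)
  qed
next
  fix g :: "('v,'e) generator" assume "g \<notin> generators E"
  from outside_zero [OF this] show "phi (free_gen g) \<doteq> 0"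
    by (cases g) (simp_all add: lcong_mult_zero)
qed simp_all

lemma generator_classes:
  "v \<in> verts E \<Longrightarrow> P_vertex E v = qt (P v)" "e \<in> arcs E \<Longrightarrow> S_edge E e = qt (S e)"
  by (simp_all add: P_vertex_def S_edge_def leavitt_gen_eq generators_def)

text \<open>Ghosts are adjoints of edges, so a homomorphism that respects adjoints is determined by
  its values on vertices and edges.\<close>

lemma Lambda_unique:
  assumes endo: "unital_star_endo E \<psi>"
    and edge: "\<And>e. e \<in> arcs E \<Longrightarrow> \<psi> (S_edge E e) = u_elem E J \<otimes>\<^bsub>leavitt E\<^esub> S_edge E e"
    and vertex: "\<And>v. v \<in> verts E \<Longrightarrow> \<psi> (P_vertex E v) = P_vertex E v"
  shows "\<psi> (qt p) = qt (phi p)"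
proof -
  interpret L: ring "leavitt E" by (rule ring_L)
  have hom: "\<psi> \<in> ring_hom (leavitt E) (leavitt E)"
    and star: "\<psi> (leavitt_star (qt p)) = leavitt_star (\<psi> (qt p))" for p
    using endo qt_hom(4) by (auto simp: unital_star_endo_def)
  interpret H: ring_hom_ring "leavitt E" "leavitt E" \<psi>
    using hom by unfold_locales
  show ?thesis
  proof (induction p rule: free_induct)
    case one
    then show ?case by (simp add: qt_hom(3))
  next
    case (gen g)
    show ?case
    proof (cases "g \<in> generators E")
      case True
      then show ?thesis
      proof (cases g)
        case (Ghost e)
        with True have e: "e \<in> arcs E" by (auto simp: generators_def)
        have "qt (T e) = leavitt_star (qt (S e))" by (simp add: leavitt_star_qt)
        then show ?thesis
          using edge [OF e] e Ghost star [of "S e"]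
          by (simp add: generator_classes u_elem_eq leavitt_star_qt free_star_mult flip: qt_hom(2))
      qed (use edge vertex in \<open>auto simp: generators_def generator_classes u_elem_eq simp flip: qt_hom(2)\<close>)
    next
      case False
      then have "qt (free_gen g) = \<zero>\<^bsub>leavitt E\<^esub>" "qt (phi (free_gen g)) = \<zero>\<^bsub>leavitt E\<^esub>"
        using phi_lcong [OF outside_zero [OF False]] outside_zero [OF False]
        by (simp_all add: qt_eq_iff flip: qt_zero)
      then show ?thesis by simp
    qed
  next
    case (diff p q)
    have "qt (p - q) = qt p \<ominus>\<^bsub>leavitt E\<^esub> qt q" for p q
      by (simp add: a_minus_def qt_uminus flip: qt_hom(1))
    then show ?case using diff by (simp add: qt_hom(4) a_minus_def)
  next
    case (mult p q)
    then show ?case by (simp add: qt_hom(2,4))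
  qed
qed

lemma Lambda_qt: "Lambda E J (qt p) = qt (phi p)"
proof -
  let ?C = "carrier (leavitt E)"
  \<comment> \<open>The chosen representative does not matter by \<open>phi_lcong\<close>; the
    restriction meets the extensionality clause in \<open>Lambda\<close>.\<close>
  define L where "L = restrict (\<lambda>X. qt (phi (SOME p. X = qt p))) ?C"
  have L: "L (qt p) = qt (phi p)" for p
  proof -
    have "qt p = qt (SOME q. qt p = qt q)" by (rule someI) (rule refl)
    then have "qt (phi p) = qt (phi (SOME q. qt p = qt q))"
      by (simp only: qt_eq_iff phi_lcong)
    then show ?thesis by (simp add: L_def qt_hom(4))
  qed
  let ?Q = "\<lambda>\<phi>. \<phi> \<in> extensional ?C \<and> unital_star_endo E \<phi> \<and>
       (\<forall>e\<in>arcs E. \<phi> (S_edge E e) = u_elem E J \<otimes>\<^bsub>leavitt E\<^esub> S_edge E e) \<and>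
       (\<forall>v\<in>verts E. \<phi> (P_vertex E v) = P_vertex E v)"
  have "L \<in> ring_hom (leavitt E) (leavitt E)"
  proof (rule ring_hom_memI)
    fix X Y assume "X \<in> ?C" "Y \<in> ?C"
    then obtain p q where "X = qt p" "Y = qt q" by (metis carrier_leavittE)
    then show "L X \<in> ?C" "L (X \<otimes>\<^bsub>leavitt E\<^esub> Y) = L X \<otimes>\<^bsub>leavitt E\<^esub> L Y"
      "L (X \<oplus>\<^bsub>leavitt E\<^esub> Y) = L X \<oplus>\<^bsub>leavitt E\<^esub> L Y"
      by (simp_all add: L qt_hom(4) flip: qt_hom(1,2))
  qed (simp add: L flip: qt_hom(3))
  moreover have "L (leavitt_star X) = leavitt_star (L X)" if "X \<in> ?C" for X
    using that by (auto elim!: carrier_leavittE simp: leavitt_star_qt L phi_star)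
  ultimately have Q: "?Q L"
    by (auto simp: unital_star_endo_def generator_classes L u_elem_eq L_def [symmetric] simp flip: qt_hom(2))
      (simp add: L_def)
  have "Lambda E J = L"
    unfolding Lambda_def
  proof (rule the_equality)
    fix \<psi> assume \<psi>: "?Q \<psi>"
    then have "\<psi> (qt p) = L (qt p)" for p
      using Lambda_unique [of \<psi>] L by blast
    then show "\<psi> = L"
      using \<psi> Q by (intro extensionalityI [of _ ?C]) (auto elim: carrier_leavittE)
  qed (rule Q)
  then show ?thesis by (simp add: L)
qed

lemma Lambda_hom: "Lambda E J \<in> ring_hom (leavitt E) (leavitt E)"
proof (rule ring_hom_memI)
  fix X Y assume "X \<in> carrier (leavitt E)" "Y \<in> carrier (leavitt E)"
  then obtain p q where "X = qt p" "Y = qt q" by (metis carrier_leavittE)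
  then show "Lambda E J X \<in> carrier (leavitt E)"
    "Lambda E J (X \<otimes>\<^bsub>leavitt E\<^esub> Y) = Lambda E J X \<otimes>\<^bsub>leavitt E\<^esub> Lambda E J Y"
    "Lambda E J (X \<oplus>\<^bsub>leavitt E\<^esub> Y) = Lambda E J X \<oplus>\<^bsub>leavitt E\<^esub> Lambda E J Y"
    by (simp_all add: Lambda_qt qt_hom(4) flip: qt_hom(1,2))
qed (simp add: Lambda_qt flip: qt_hom(3))

section \<open>Invariance of the diagonal and injectivity on it\<close>

text \<open>Cross terms for distinct pairs compress \<open>d\<close> between incomparable second
  components or different sources, hence vanish; each remaining term compresses \<open>d\<close> by
  \<open>kap j\<close> and transports it along \<open>mu j\<close>.\<close>

lemma U_diag_U':
  assumes sinks: "no_sinks E" and d: "d \<in> diag"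
  shows "U * d * U' \<in> diag"
proof -
  have "U * d * U' = (\<Sum>j\<in>J. \<Sum>k\<in>J. spath (src j) (mu j) *
    (tpath (src j) (kap j) * d * spath (src k) (kap k)) * tpath (src k) (mu k))"
    unfolding U'_eq unfolding U_def sum_distrib_right sum_distrib_left
    by (subst sum.swap) (simp add: mult.assoc)
  also have "\<dots> \<in> diag"
  proof (intro diag_sum)
    fix j k assume jk: "j \<in> J" "k \<in> J"
    obtain v where v: "awalk (src j) (mu j) v" "awalk (src j) (kap j) v"
      using jk(1) by (rule J_walkE)
    obtain w where w: "awalk (src k) (mu k) w" "awalk (src k) (kap k) w"
      using jk(2) by (rule J_walkE)
    show "spath (src j) (mu j) * (tpath (src j) (kap j) * d * spath (src k) (kap k)) *
      tpath (src k) (mu k) \<in> diag"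
    proof (cases "j = k")
      case True
      then show ?thesis
        using v d by (auto intro: spath_diag_tpath tpath_diag_spath)
    next
      case False
      then have "src j \<noteq> src k \<or> src j = src k \<and> kap j \<parallel> kap k"
        using kap_incomparable [OF sinks jk] by blast
      then have "tpath (src j) (kap j) * d * spath (src k) (kap k) \<doteq> 0"
      proof (elim disjE conjE)
        assume "src j = src k" "kap j \<parallel> kap k"
        then show ?thesis
          using tpath_diag_spath_parallel [OF v(2) _ _ d, of "kap k" w] w by simp
      qed (rule tpath_diag_spath_neq [OF _ d])
      then show ?thesis by (rule diag_zeroI [OF lcong_mult_zero(3)])
    qed
  qed
  finally show ?thesis .
qed

text \<open>For a walk \<open>e # p\<close> the image arises from that of \<open>p\<close> by
  conjugation with \<open>S e\<close> followed by conjugation with \<open>U\<close>, and both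
  preserve \<open>diag\<close>.\<close>

lemma phi_diag:
  assumes sinks: "no_sinks E" and d: "d \<in> diag"
  shows "phi d \<in> diag"
  using d
proof induction
  case (path u p v)
  then show ?case
  proof (induction p arbitrary: u)
    case Nil
    then have "P u \<in> diag"
      using diag.path [OF Nil] lcong_sym [OF proj_Nil [of u]] diag.lcong by blast
    then show ?case
      using phi_lcong [OF proj_Nil [of u]] by (auto intro: diag.lcong)
  next
    case (Cons e p)
    then have e: "e \<in> arcs E" "u = tail E e" "phi (proj (head E e) p) \<in> diag"
      by (auto simp: awalk_Cons_iff)
    have "phi (proj u (e # p)) \<doteq> phi (S e * proj (head E e) p * T e)"
      unfolding e(2) by (intro phi_lcong proj_Cons e)
    also have "\<dots> = U * (S e * phi (proj (head E e) p) * T e) * U'"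
      by (simp add: mult.assoc)
    finally have "phi (proj u (e # p)) \<doteq> U * (S e * phi (proj (head E e) p) * T e) * U'" .
    then show ?case
      by (rule diag.lcong [rotated]) (intro U_diag_U' sinks S_diag_T e)
  qed
next
  case (lcong d d')
  then show ?case using phi_lcong diag.lcong by blast
qed (auto intro: diag.intros)

lemma phi_diag_injective:
  assumes sinks: "no_sinks E" and d: "d \<in> diag" and zero: "phi d \<doteq> 0"
  shows "d \<doteq> 0"
proof -
  obtain n where n: "\<And>u p v. awalk u p v \<Longrightarrow> length p \<ge> n \<Longrightarrow>
    \<exists>c. tpath u p * d * spath u p \<doteq> of_int c * P v"
    using tpath_diag_spath_scalar [OF d] by blast
  show ?thesis
  proof (rule diag_zero_if_compressions_zero [OF d])
    fix u p assume "(u, p) \<in> npaths n"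
    then obtain v where v: "awalk u p v" "length p = n" by (auto simp: npaths_def)
    obtain c where c: "tpath u p * d * spath u p \<doteq> of_int c * P v"
      using n v by blast
    have "of_int c * P v \<doteq> phi (tpath u p * d * spath u p)"
      using phi_lcong [OF lcong_sym [OF c]] by simp
    also have "\<dots> \<doteq> 0"
      using zero by (auto intro: lcong_mult_zero)
    finally have "c = 0"
      using of_int_P_zero [OF sinks awalk_last_in_verts [OF v(1)]] by blast
    with c show "tpath u p * d * spath u p \<doteq> 0" by simp
  qed
qed

end

section \<open>Products along paths in the coding graph\<close>

locale coding = admissible_pairs E J
  for E :: "('v,'e) pre_digraph" and J :: "('v,'e) coding_vertex set" +
  assumes no_sinks: "no_sinks E"
    and non_negative: "\<forall>a\<in>arcs (coding_graph E J). non_negative_edge E a"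
    and no_non_positive: "\<not> (\<exists>\<omega>. wf_digraph.closed_w (coding_graph E J) \<omega> \<and> non_positive_path E \<omega>)"
begin

abbreviation lab :: "('v,'e) coding_vertex \<Rightarrow> 'e" where "lab j \<equiv> hd (kap j)"
abbreviation nu :: "('v,'e) coding_vertex \<Rightarrow> 'e list" where "nu j \<equiv> tl (kap j)"

definition jend :: "('v,'e) coding_vertex \<Rightarrow> 'v" where
  "jend j = awlast (src j) (kap j)"

definition jarc :: "('v,'e) coding_vertex \<Rightarrow> ('v,'e) coding_vertex \<Rightarrow> bool" where
  "jarc j k \<longleftrightarrow> (j, k) \<in> arcs (coding_graph E J)"

text \<open>What remains of the summand of \<open>U\<close> at \<open>j\<close> after right
  multiplication by \<open>S (lab j)\<close>.\<close>

definition branch :: "('v,'e) coding_vertex \<Rightarrow> ('v,'e) free_elem" where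
  "branch j = spath (src j) (mu j) * tpath (head E (lab j)) (nu j)"

lemma J_walks:
  assumes "j \<in> J"
  shows "awalk (src j) (mu j) (jend j)" "kap j = lab j # nu j"
    "lab j \<in> arcs E" "tail E (lab j) = src j" "awalk (head E (lab j)) (nu j) (jend j)"
    "j = ((src j, mu j), (src j, kap j))"
proof -
  obtain v where v: "awalk (src j) (mu j) v" "awalk (src j) (kap j) v" "kap j \<noteq> []" "fst (snd j) = src j"
    using assms by (rule J_walkE)
  then have [simp]: "v = jend j" by (auto simp: jend_def)
  show "awalk (src j) (mu j) (jend j)" using v by simp
  show k: "kap j = lab j # nu j" using v by simp
  have "awalk (src j) (lab j # nu j) (jend j)" using v k by simp
  then show "lab j \<in> arcs E" "tail E (lab j) = src j" "awalk (head E (lab j)) (nu j) (jend j)"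
    by (auto simp: awalk_Cons_iff)
  show "j = ((src j, mu j), (src j, kap j))" using v by (metis prod.collapse)
qed

lemma jarc_J: "jarc j k \<Longrightarrow> j \<in> J \<and> k \<in> J"
  by (auto simp: jarc_def coding_graph_def)

lemma coding_label_eq:
  assumes "j \<in> J" "k \<in> J"
  shows "coding_label E (j, k) = qt (tpath (head E (lab j)) (nu j) * spath (src k) (mu k))"
proof -
  have "coding_label E (((src j, mu j), (src j, kap j)), ((src k, mu k), (src k, kap k))) =
      leavitt_star (S_path E (head E (lab j), nu j)) \<otimes>\<^bsub>leavitt E\<^esub> S_path E (src k, mu k)"
    by (simp only: coding_label.simps path_rest_def path_edge_def snd_conv)
  moreover have "S_path E (head E (lab j), nu j) = qt (spath (head E (lab j)) (nu j))"
    using J_walks(5) [OF assms(1)] by (intro S_path_eq) (auto simp: paths_def)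
  moreover have "S_path E (src k, mu k) = qt (spath (src k) (mu k))"
    by (rule S_path_eq) (use J_walks(1) [OF assms(2)] in \<open>auto simp: paths_def simp del: prod.collapse\<close>)
  ultimately show ?thesis
    using J_walks(6) [OF assms(1)] J_walks(6) [OF assms(2)] by (metis leavitt_star_qt free_star_spath qt_hom(2))
qed

lemma not_jarc_zero:
  assumes "j \<in> J" "k \<in> J" "\<not> jarc j k"
  shows "tpath (head E (lab j)) (nu j) * spath (src k) (mu k) \<doteq> 0"
  using assms coding_label_eq [OF assms(1,2)]
  by (auto simp: jarc_def coding_graph_def qt_eq_iff simp flip: qt_zero)

text \<open>A nonzero label forces equal sources and comparable paths. If \<open>nu j\<close> were
  properly longer than \<open>mu k\<close>, the label would be the adjoint of a path of positive
  length, of negative degree.\<close>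

lemma jarc_extends:
  assumes "jarc j k"
  shows "src k = head E (lab j)" "prefix (nu j) (mu k)"
    "edge_degree E (j, k) = int (length (mu k) - length (nu j))"
proof -
  have jk: "j \<in> J" "k \<in> J" using jarc_J [OF assms] by auto
  note w = J_walks(5) [OF jk(1)] J_walks(1) [OF jk(2)]
  have label: "coding_label E (j, k) = qt (tpath (head E (lab j)) (nu j) * spath (src k) (mu k))"
    by (rule coding_label_eq [OF jk])
  have nz: "\<not> tpath (head E (lab j)) (nu j) * spath (src k) (mu k) \<doteq> 0"
    using assms label by (auto simp: jarc_def coding_graph_def qt_eq_iff simp flip: qt_zero)
  then show src: "src k = head E (lab j)"
    using tpath_spath_neq by metis
  then have np: "\<not> nu j \<parallel> mu k"
    using nz w tpath_spath_parallel by metis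
  have nonneg: "edge_degree E (j, k) \<ge> 0"
    using assms non_negative by (auto simp: jarc_def non_negative_edge_def)
  have "prefix (nu j) (mu k) \<and> edge_degree E (j, k) = int (length (mu k) - length (nu j))"
  proof (cases "prefix (nu j) (mu k)")
    case True
    then obtain g where g: "mu k = nu j @ g" by (auto simp: prefix_def)
    have "awalk (jend j) g (jend k)" using w src g by auto
    moreover have "tpath (head E (lab j)) (nu j) * spath (src k) (mu k) \<doteq> spath (jend j) g"
      using w src g by (auto intro: tpath_spath_append)
    ultimately show ?thesis
      using edge_degree_spath [OF no_sinks] label g by (simp add: qt_eq_iff)
  next
    case False
    with np obtain g where g: "nu j = mu k @ g" "g \<noteq> []" by (auto simp: parallel_def prefix_def)
    have "awalk (jend k) g (jend j)" using w src g by auto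
    moreover have "tpath (head E (lab j)) (nu j) * spath (src k) (mu k) \<doteq> tpath (jend k) g"
      using w src g by (auto intro: tpath_append_spath)
    ultimately have "edge_degree E (j, k) = - int (length g)"
      using edge_degree_tpath [OF no_sinks] label by (simp add: qt_eq_iff)
    then show ?thesis using nonneg g by simp
  qed
  then show "prefix (nu j) (mu k)" "edge_degree E (j, k) = int (length (mu k) - length (nu j))"
    by auto
qed

lemma U_S:
  assumes "e \<in> arcs E"
  shows "U * S e \<doteq> (\<Sum>j\<in>{j\<in>J. lab j = e}. branch j)"
proof -
  have "tpath (src j) (kap j) * S e \<doteq> (if lab j = e then tpath (head E (lab j)) (nu j) else 0)"
    if j: "j \<in> J" for j
  proof -
    note w = J_walks [OF j]
    have "tpath (src j) (kap j) * S e \<doteq> tpath (head E (lab j)) (nu j) * T (lab j) * S e"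
      using tpath_Cons [OF w(3), of "nu j"] w(2,4) by (intro lcong_mult) auto
    also have "\<dots> = tpath (head E (lab j)) (nu j) * (T (lab j) * S e)"
      by (simp add: mult.assoc)
    also have "\<dots> \<doteq> tpath (head E (lab j)) (nu j) * (if lab j = e then P (head E (lab j)) else 0)"
      using T_S [OF w(3) assms] by (intro lcong_mult lcong_refl)
    also have "\<dots> \<doteq> (if lab j = e then tpath (head E (lab j)) (nu j) else 0)"
      using tpath_P [of "head E (lab j)" "nu j" "head E (lab j)"] by auto
    finally show ?thesis .
  qed
  then have "(\<Sum>j\<in>J. spath (src j) (mu j) * (tpath (src j) (kap j) * S e)) \<doteq>
      (\<Sum>j\<in>J. spath (src j) (mu j) * (if lab j = e then tpath (head E (lab j)) (nu j) else 0))"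
    by (intro lcong_sum lcong_mult lcong_refl)
  also have "\<dots> = (\<Sum>j\<in>{j\<in>J. lab j = e}. branch j)"
    by (rule sum.mono_neutral_cong_right) (auto simp: finite_J branch_def)
  finally show ?thesis
    by (simp add: U_def sum_distrib_right mult.assoc)
qed

section \<open>Expansion along paths with a given edge word\<close>

definition labelled :: "'e list \<Rightarrow> ('v,'e) coding_vertex list set" where
  "labelled es = {js. set js \<subseteq> J \<and> map lab js = es}"

lemma phi_spath_expand:
  assumes "set es \<subseteq> arcs E"
  shows "phi (spath u es) \<doteq> (\<Sum>js\<in>labelled es. P u * prod_list (map branch js))"
proof -
  have "phi (prod_list (map S es)) \<doteq> (\<Sum>js\<in>labelled es. prod_list (map branch js))"
    using assms
  proof (induction es)
    case Nil
    have "labelled [] = {[]}" by (auto simp: labelled_def)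
    then show ?case by simp
  next
    case (Cons e es)
    have "phi (prod_list (map S (e # es))) = (U * S e) * phi (prod_list (map S es))"
      by simp
    also have "\<dots> \<doteq> (\<Sum>j\<in>{j\<in>J. lab j = e}. branch j) * (\<Sum>js\<in>labelled es. prod_list (map branch js))"
      using Cons by (intro lcong_mult U_S) auto
    also have "\<dots> = (\<Sum>(j, js)\<in>{j\<in>J. lab j = e} \<times> labelled es. branch j * prod_list (map branch js))"
      by (simp add: sum_product sum.cartesian_product)
    also have "\<dots> = (\<Sum>js\<in>labelled (e # es). prod_list (map branch js))"
      by (rule sum.reindex_bij_witness [of _ "\<lambda>js. (hd js, tl js)" "\<lambda>(j, js). j # js"])
        (auto simp: labelled_def)
    finally show ?case .
  qed
  then have "P u * phi (prod_list (map S es)) \<doteq> P u * (\<Sum>js\<in>labelled es. prod_list (map branch js))"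
    by (intro lcong_mult lcong_refl)
  then show ?thesis by (simp add: spath_def sum_distrib_left)
qed

text \<open>
  For a path with vertices \<open>(\<mu>\<^sub>i, e\<^sub>i\<nu>\<^sub>i)\<close> and labels \<open>S\<^sub>\<alpha>\<close> with \<open>\<mu>\<^sub>i\<^sub>+\<^sub>1 = \<nu>\<^sub>i\<alpha>\<^sub>i\<close>, this is the path
  \<open>\<mu>\<^sub>1\<alpha>\<^sub>1\<alpha>\<^sub>2\<dots>\<close>, and \<open>growth\<close> below is the sum of the lengths of the \<open>\<alpha>\<^sub>i\<close>.
\<close>

fun tau :: "('v,'e) coding_vertex list \<Rightarrow> 'e list" where
  "tau [] = []"
| "tau [j] = mu j"
| "tau (j # k # js) = mu j @ drop (length (nu j)) (tau (k # js))"

text \<open>The prefix clause carries the induction: \<open>nu j\<close> is a prefix of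
  \<open>mu k\<close>, hence of \<open>tau (k # js)\<close>, so the \<open>drop\<close> in
  \<open>tau\<close> removes exactly \<open>nu j\<close>.\<close>

lemma tau_walk:
  assumes "successively jarc js" "js \<noteq> []" "set js \<subseteq> J"
  shows "awalk (src (hd js)) (tau js) (jend (last js)) \<and> prefix (mu (hd js)) (tau js)"
  using assms
proof (induction js rule: tau.induct)
  case (2 j)
  then show ?case using J_walks(1) [of j] by simp
next
  case (3 j k js)
  then have jk: "jarc j k" "j \<in> J" "k \<in> J" by auto
  have IH: "awalk (src k) (tau (k # js)) (jend (last (k # js)))" "prefix (mu k) (tau (k # js))"
    using 3 by auto
  obtain r where r: "tau (k # js) = nu j @ r"
    using IH(2) jarc_extends(2) [OF jk(1)] by (auto simp: prefix_def)
  have "awalk (jend j) r (jend (last (k # js)))"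
    using IH(1) J_walks(5) [OF jk(2)] jarc_extends(1) [OF jk(1)] by (auto simp: r)
  then show ?case
    using J_walks(1) [OF jk(2)] r by (auto simp: awalk_appendI)
qed simp

text \<open>Telescoping from the right: the adjoint path in \<open>branch j\<close> cancels the
  initial \<open>nu j\<close> of \<open>tau (k # js)\<close>.\<close>

lemma branch_product:
  assumes "successively jarc js" "js \<noteq> []" "set js \<subseteq> J"
  shows "prod_list (map branch js) \<doteq>
    spath (src (hd js)) (tau js) * tpath (head E (lab (last js))) (nu (last js))"
  using assms
proof (induction js rule: tau.induct)
  case (2 j)
  then show ?case by (simp add: branch_def)
next
  case (3 j k js)
  then have jk: "jarc j k" "j \<in> J" "k \<in> J" by auto
  let ?l = "last (k # js)"
  let ?t = "tpath (head E (lab ?l)) (nu ?l)"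
  have w: "awalk (src k) (tau (k # js)) (jend ?l)" "prefix (mu k) (tau (k # js))"
    using tau_walk [of "k # js"] 3 by auto
  obtain r where r: "tau (k # js) = nu j @ r"
    using w(2) jarc_extends(2) [OF jk(1)] by (auto simp: prefix_def)
  have jr: "awalk (jend j) r (jend ?l)"
    using w(1) J_walks(5) [OF jk(2)] jarc_extends(1) [OF jk(1)] by (auto simp: r)
  have "prod_list (map branch (k # js)) \<doteq> spath (src k) (tau (k # js)) * ?t"
    using "3.IH" "3.prems" by simp
  from lcong_mult [OF lcong_refl this, of "branch j"]
  have "prod_list (map branch (j # k # js)) \<doteq> branch j * (spath (src k) (tau (k # js)) * ?t)"
    by simp
  also have "\<dots> = spath (src j) (mu j) * (tpath (src k) (nu j) * spath (src k) (nu j @ r)) * ?t"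
    using jarc_extends(1) [OF jk(1)] by (simp add: branch_def r mult.assoc)
  also have "\<dots> \<doteq> spath (src j) (mu j) * spath (jend j) r * ?t"
    using J_walks(5) [OF jk(2)] jarc_extends(1) [OF jk(1)] w(1)
    by (intro lcong_sandwich tpath_spath_append) (auto simp: r)
  also have "\<dots> \<doteq> spath (src j) (mu j @ r) * ?t"
    using J_walks(1) [OF jk(2)] jr
    by (intro lcong_mult lcong_refl lcong_sym [OF spath_append]) (auto intro: awalk_appendI)
  finally show ?case by (simp add: r)
qed simp

lemma branch_product_zero:
  assumes "\<not> successively jarc js" "set js \<subseteq> J"
  shows "prod_list (map branch js) \<doteq> 0"
  using assms
proof (induction js rule: tau.induct)
  case (3 j k js)
  show ?case
  proof (cases "jarc j k")
    case True
    then have "prod_list (map branch (k # js)) \<doteq> 0" using 3 by auto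
    from lcong_mult_zero(1) [OF this, of "branch j"] show ?thesis by simp
  next
    case False
    then have "tpath (head E (lab j)) (nu j) * spath (src k) (mu k) \<doteq> 0"
      using 3 by (intro not_jarc_zero) auto
    then have "spath (src j) (mu j) * (tpath (head E (lab j)) (nu j) * spath (src k) (mu k)) *
        (tpath (head E (lab k)) (nu k) * X) \<doteq> 0" for X
      by (rule lcong_mult_zero(3))
    then have "branch j * (branch k * X) \<doteq> 0" for X
      by (simp add: branch_def mult.assoc)
    then show ?thesis by simp
  qed
qed simp_all

text \<open>Later vertices only append edges, because \<open>tau\<close> of a path begins with the
  \<open>mu\<close> of its first vertex. Thus initial vertices fix initial edges.\<close>

lemma tau_prefix:
  assumes "successively jarc (js @ ks)" "js \<noteq> []" "set (js @ ks) \<subseteq> J"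
  shows "prefix (tau js) (tau (js @ ks))"
  using assms
proof (induction js rule: tau.induct)
  case (2 j)
  then show ?case using tau_walk [of "j # ks"] by auto
next
  case (3 j k js)
  then have "prefix (tau (k # js)) (tau (k # js @ ks))" by auto
  then show ?case by (auto simp: prefix_def)
qed simp

fun growth :: "('v,'e) coding_vertex list \<Rightarrow> nat" where
  "growth (j # k # js) = (length (mu k) - length (nu j)) + growth (k # js)"
| "growth _ = 0"

text \<open>Only an inequality, as the edge joining the two pieces is counted on the left
  alone.\<close>

lemma growth_append: "growth (xs @ ys) \<ge> growth xs + growth ys"
proof (induction xs rule: growth.induct)
  case ("2_2" j)
  then show ?case by (cases ys) auto
qed auto

lemma length_tau:
  assumes "successively jarc js" "js \<noteq> []" "set js \<subseteq> J"
  shows "length (tau js) = length (mu (hd js)) + growth js"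
  using assms
proof (induction js rule: tau.induct)
  case (3 j k js)
  then have "length (nu j) \<le> length (mu k)"
    using jarc_extends(2) [of j k] by (auto dest: prefix_length_le)
  then show ?case using 3 by auto
qed simp_all

sublocale CG: wf_digraph "coding_graph E J"
  by unfold_locales (auto simp: coding_graph_def)

text \<open>An edge of the coding graph is the pair of its ends, so \<open>zip js (tl js)\<close>
  lists the edges of the path that visits \<open>js\<close>.\<close>

lemma jarc_walk:
  assumes "successively jarc js" "js \<noteq> []" "set js \<subseteq> J"
  shows "CG.awalk (hd js) (zip js (tl js)) (last js)" "CG.awalk_verts (hd js) (zip js (tl js)) = js"
proof -
  have "CG.awalk (hd js) (zip js (tl js)) (last js) \<and> CG.awalk_verts (hd js) (zip js (tl js)) = js"
    using assms
  proof (induction js rule: tau.induct)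
    case (2 j)
    then show ?case by (simp add: CG.awalk_Nil_iff) (simp add: coding_graph_def)
  next
    case (3 j k js)
    then have "(j, k) \<in> arcs (coding_graph E J)" by (simp add: jarc_def)
    with 3 show ?case by (auto simp: CG.awalk_Cons_iff) (simp_all add: coding_graph_def)
  qed simp
  then show "CG.awalk (hd js) (zip js (tl js)) (last js)" "CG.awalk_verts (hd js) (zip js (tl js)) = js"
    by auto
qed

lemma growth_zero_degree:
  assumes "successively jarc js" "growth js = 0" "(j, k) \<in> set (zip js (tl js))"
  shows "edge_degree E (j, k) = 0"
  using assms
proof (induction js rule: tau.induct)
  case (3 j' k' js)
  then show ?case using jarc_extends(3) [of j' k'] by auto
qed simp_all

text \<open>A closed path of growth \<open>0\<close> would have only edges of degree
  \<open>0\<close> and so be a non-positive cycle.\<close>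

lemma growth_closed:
  assumes "successively jarc (y # ys @ [y])" "set (y # ys) \<subseteq> J"
  shows "growth (y # ys @ [y]) \<ge> 1"
proof (rule ccontr)
  let ?js = "y # ys @ [y]"
  let ?w = "zip ?js (tl ?js)"
  assume "\<not> growth ?js \<ge> 1"
  then have "growth ?js = 0" by simp
  then have "edge_degree E a = 0" if "a \<in> set ?w" for a
    using growth_zero_degree [OF assms(1), of "fst a" "snd a"] that by simp
  then have "non_positive_path E ?w" by (simp add: non_positive_path_def)
  moreover have "CG.awalk (hd ?js) ?w (last ?js)"
    using assms by (intro jarc_walk) auto
  then have "CG.closed_w ?w" unfolding CG.closed_w_def by (intro exI [of _ y]) simp
  ultimately show False using no_non_positive by blast
qed

text \<open>By the pigeonhole principle each block of \<open>Suc (card J)\<close> vertices contains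
  a closed path, which contributes at least \<open>1\<close>.\<close>

lemma growth_long:
  assumes "successively jarc js" "set js \<subseteq> J" "length js \<ge> n * Suc (card J)"
  shows "growth js \<ge> n"
  using assms
proof (induction n arbitrary: js)
  case (Suc n)
  define xs ys where "xs = take (Suc (card J)) js" and "ys = drop (Suc (card J)) js"
  have js: "js = xs @ ys" by (simp add: xs_def ys_def)
  have "length xs = Suc (card J)" using Suc.prems(3) by (simp add: xs_def)
  moreover have "card (set xs) \<le> card J"
    using Suc.prems(2) js by (intro card_mono finite_J) auto
  ultimately have "\<not> distinct xs" using distinct_card [of xs] by auto
  then obtain as y bs cs where xs: "xs = as @ (y # bs @ [y]) @ cs"
    using not_distinct_decomp [of xs] by auto
  have "successively jarc (y # bs @ [y])"
    using Suc.prems(1) unfolding js xs by (simp only: successively_append_iff)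
  then have "1 \<le> growth (y # bs @ [y])"
    using Suc.prems(2) by (intro growth_closed) (auto simp: js xs)
  also have "\<dots> \<le> growth xs"
    using growth_append [of as "(y # bs @ [y]) @ cs"] growth_append [of "y # bs @ [y]" cs]
    by (simp add: xs)
  finally have "1 \<le> growth xs" .
  moreover have "length ys \<ge> n * Suc (card J)"
    using Suc.prems(3) by (simp add: ys_def)
  then have "n \<le> growth ys"
    using Suc.prems(1,2) by (intro Suc.IH) (auto simp: js successively_append_iff)
  ultimately show ?case using growth_append [of xs ys] by (simp add: js)
qed simp

end

section \<open>Left synchronization and surjectivity\<close>

locale synchronizing_coding = coding E J
  for E :: "('v,'e) pre_digraph" and J :: "('v,'e) coding_vertex set" +
  assumes sync: "left_synchronizing E J"
begin

text \<open>A path of length \<open>m\<close> visits \<open>Suc m\<close> vertices, and its edge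
  word has one letter for each.\<close>

lemma synchronizing_delay:
  obtains m where "\<And>js ks. successively jarc js \<Longrightarrow> successively jarc ks \<Longrightarrow> set js \<subseteq> J \<Longrightarrow> set ks \<subseteq> J \<Longrightarrow>
    length js = Suc m \<Longrightarrow> length ks = Suc m \<Longrightarrow> map lab js = map lab ks \<Longrightarrow> hd js = hd ks"
proof -
  obtain m where m: "\<And>x y \<omega> x' y' \<omega>'. CG.awalk x \<omega> y \<Longrightarrow> length \<omega> = m \<Longrightarrow> CG.awalk x' \<omega>' y' \<Longrightarrow>
      length \<omega>' = m \<Longrightarrow> edge_word E J x \<omega> = edge_word E J x' \<omega>' \<Longrightarrow> x = x'"
    using sync unfolding left_synchronizing_def by metis
  show thesis
  proof (rule that)
    fix js ks
    assume *: "successively jarc js" "successively jarc ks" "set js \<subseteq> J" "set ks \<subseteq> J"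
      "length js = Suc m" "length ks = Suc m" "map lab js = map lab ks"
    have word: "edge_word E J (hd ls) (zip ls (tl ls)) = map lab ls"
      if "successively jarc ls" "set ls \<subseteq> J" "length ls = Suc m" for ls
    proof -
      have "ls \<noteq> []" using that(3) by auto
      then show ?thesis
        using jarc_walk(2) [of ls] that by (simp add: edge_word_def path_edge_def)
    qed
    show "hd js = hd ks"
    proof (rule m)
      show "CG.awalk (hd js) (zip js (tl js)) (last js)" "CG.awalk (hd ks) (zip ks (tl ks)) (last ks)"
        using * by (auto intro!: jarc_walk(1))
    qed (use * word in auto)
  qed
qed

text \<open>Synchronization is applied to the window of \<open>Suc m\<close> vertices at each
  position below \<open>K\<close>; the length \<open>K + m\<close> is just enough for the last
  window.\<close>

lemma labelled_take_eq:
  obtains m where "\<And>js ks es K. js \<in> labelled es \<Longrightarrow> ks \<in> labelled es \<Longrightarrow> length es = K + m \<Longrightarrow>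
    successively jarc js \<Longrightarrow> successively jarc ks \<Longrightarrow> take K js = take K ks"
proof -
  obtain m where m: "\<And>js ks. successively jarc js \<Longrightarrow> successively jarc ks \<Longrightarrow> set js \<subseteq> J \<Longrightarrow> set ks \<subseteq> J \<Longrightarrow>
    length js = Suc m \<Longrightarrow> length ks = Suc m \<Longrightarrow> map lab js = map lab ks \<Longrightarrow> hd js = hd ks"
    using synchronizing_delay by metis
  show thesis
  proof (rule that [of m])
    fix js ks es K
    assume *: "js \<in> labelled es" "ks \<in> labelled es" "length es = K + m"
      "successively jarc js" "successively jarc ks"
    have len: "length js = K + m" "length ks = K + m"
      using * by (auto simp: labelled_def dest: arg_cong [of _ _ length])
    have "js ! i = ks ! i" if "i < K" for i
    proof -
      let ?f = "\<lambda>ls. take (Suc m) (drop i ls)"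
      have f: "successively jarc (?f ls) \<and> set (?f ls) \<subseteq> J \<and> length (?f ls) = Suc m \<and> hd (?f ls) = ls ! i"
        if ls: "successively jarc ls" "set ls \<subseteq> J" "length ls = K + m" for ls
      proof (intro conjI)
        show "successively jarc (?f ls)"
          using ls(1) \<open>i < K\<close> by (auto simp: successively_conv_nth)
        show "set (?f ls) \<subseteq> J"
          using ls(2) by (meson order_trans set_drop_subset set_take_subset)
        show "length (?f ls) = Suc m" using ls(3) \<open>i < K\<close> by simp
        show "hd (?f ls) = ls ! i" using ls(3) \<open>i < K\<close> by (simp add: hd_drop_conv_nth)
      qed
      have "map lab (?f js) = map lab (?f ks)"
        using * by (simp add: labelled_def flip: take_map drop_map)
      then have "hd (?f js) = hd (?f ks)"
        using f [of js] f [of ks] * len by (intro m) (auto simp: labelled_def)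
      then show ?thesis
        using f [of js] f [of ks] * len by (auto simp: labelled_def)
    qed
    then show "take K js = take K ks"
      using len by (intro nth_take_lemma) auto
  qed
qed

lemma proj_in_image:
  assumes q: "awalk w q z"
  obtains d where "d \<in> diag" "proj w q \<doteq> phi d"
proof -
  define n where "n = length q"
  obtain m where m: "\<And>js ks es K. js \<in> labelled es \<Longrightarrow> ks \<in> labelled es \<Longrightarrow> length es = K + m \<Longrightarrow>
    successively jarc js \<Longrightarrow> successively jarc ks \<Longrightarrow> take K js = take K ks"
    using labelled_take_eq by metis
  \<comment> \<open>By \<open>growth_long\<close>, \<open>n * Suc (card J)\<close> vertices give
    \<open>tau\<close> at least \<open>n\<close> edges; the additional vertex keeps the initial part
    nonempty when \<open>n = 0\<close>.\<close>
  define K where "K = Suc (n * Suc (card J))"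
  \<comment> \<open>The image of the diagonal up to congruence. It is closed under sums, so the
    pieces cut out by the words \<open>es\<close> can be treated separately.\<close>
  define W where "W = {x. \<exists>d\<in>diag. x \<doteq> phi d}"
  have W_cong: "x \<in> W" if "y \<in> W" "x \<doteq> y" for x y
    using that lcong_trans unfolding W_def by blast
  have W_zero: "0 \<in> W"
    using diag.zero unfolding W_def by force
  have W_add: "x + y \<in> W" if xy: "x \<in> W" "y \<in> W" for x y
  proof -
    obtain d d' where "d \<in> diag" "x \<doteq> phi d" "d' \<in> diag" "y \<doteq> phi d'"
      using xy unfolding W_def by blast
    then have "d + d' \<in> diag" "x + y \<doteq> phi (d + d')"
      by (auto intro: diag_add lcong_add)
    then show ?thesis unfolding W_def by blast
  qed
  have W_sum: "sum f A \<in> W" if "\<And>a. a \<in> A \<Longrightarrow> f a \<in> W" for f :: "'v \<times> 'e list \<Rightarrow> _" and A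
    using that by (induction A rule: infinite_finite_induct) (simp_all add: W_zero W_add)
  have piece: "proj w q * phi (proj u es) \<in> W" if ues: "(u, es) \<in> npaths (K + m)" for u es
  proof -
    obtain v where es: "awalk u es v" "length es = K + m"
      using ues by (auto simp: npaths_def)
    then have arcs: "set es \<subseteq> arcs E" and "es \<noteq> []"
      by (auto simp: awalk_def K_def)
    then have es_tail: "tail E (hd es) = u" "es \<noteq> []"
      using es(1) by (auto simp: awalk_def cas_simp)
    \<comment> \<open>The condition under which \<open>proj w q\<close> fixes the contribution of
      \<open>js\<close>; otherwise it annihilates it.\<close>
    define Q where "Q js \<longleftrightarrow> w = u \<and> take n (tau js) = q" for js
    have js: "js \<noteq> [] \<and> set js \<subseteq> J \<and> src (hd js) = u \<and> length js = K + m" if "js \<in> labelled es" for js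
    proof -
      have "length js = K + m" "set js \<subseteq> J" "map lab js = es"
        using that es by (auto simp: labelled_def dest: arg_cong [of _ _ length])
      moreover from this have "js \<noteq> []" by (auto simp: K_def)
      moreover from calculation have "lab (hd js) = hd es" "hd js \<in> J" by (auto simp: hd_map)
      then have "src (hd js) = u" using J_walks(4) [of "hd js"] es_tail by simp
      ultimately show ?thesis by blast
    qed
    have tau_take: "length (tau (take K js)) \<ge> n \<and> take n (tau js) = take n (tau (take K js))"
      if "js \<in> labelled es" "successively jarc js" for js
    proof -
      have "successively jarc (take K js @ drop K js)" "take K js \<noteq> []" "set (take K js @ drop K js) \<subseteq> J"
        using js [OF that(1)] that(2) by (auto simp: K_def)
      then have pre: "prefix (tau (take K js)) (tau js)"
        using tau_prefix [of "take K js" "drop K js"] by simp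
      have "successively jarc (take K js)" "set (take K js) \<subseteq> J" "length (take K js) = K"
        using \<open>successively jarc (take K js @ drop K js)\<close> \<open>set (take K js @ drop K js) \<subseteq> J\<close> js [OF that(1)]
        by (auto simp: successively_append_iff simp del: append_take_drop_id)
      then have "n \<le> growth (take K js)"
        by (intro growth_long) (auto simp: K_def)
      also have "\<dots> \<le> length (tau (take K js))"
        using length_tau [of "take K js"] \<open>successively jarc (take K js)\<close> \<open>set (take K js) \<subseteq> J\<close>
          \<open>take K js \<noteq> []\<close> by simp
      finally show ?thesis using pre by (auto simp: prefix_def)
    qed
    \<comment> \<open>Both paths share their first \<open>K\<close> vertices, which already
      determine the first \<open>n\<close> edges of \<open>tau\<close>.\<close>
    have agree: "Q js \<longleftrightarrow> Q ks"
      if "js \<in> labelled es" "ks \<in> labelled es" "successively jarc js" "successively jarc ks" for js ks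
      using m [OF that(1,2) es(2) that(3,4)] tau_take [OF that(1,3)] tau_take [OF that(2,4)]
      by (simp add: Q_def)
    have summand: "proj w q * (P u * prod_list (map branch js)) \<doteq>
        (if Q js then P u * prod_list (map branch js) else 0)"
      if "js \<in> labelled es" "successively jarc js" for js
    proof -
      let ?s = "spath u (tau js)" and ?t = "tpath (head E (lab (last js))) (nu (last js))"
      have js': "js \<noteq> []" "set js \<subseteq> J" "src (hd js) = u" using js [OF that(1)] by auto
      have "P u * prod_list (map branch js) \<doteq> P u * (?s * ?t)"
        using branch_product [OF that(2) js'(1,2)] js'(3) by (intro lcong_mult) auto
      also have "\<dots> = P u * ?s * ?t" by (simp add: mult.assoc)
      also have "\<dots> \<doteq> ?s * ?t"
        using P_spath [of u u "tau js"] by (intro lcong_mult) auto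
      finally have 1: "P u * prod_list (map branch js) \<doteq> ?s * ?t" .
      have "awalk u (tau js) (jend (last js))"
        using tau_walk [OF that(2) js'(1,2)] js'(3) by simp
      moreover have "length q \<le> length (tau js)"
        using tau_take [OF that] n_def by (metis length_take min.absorb_iff2 min.commute)
      ultimately have "proj w q * ?s \<doteq> (if Q js then ?s else 0)"
        using proj_spath [OF q] by (simp add: Q_def n_def)
      then have "proj w q * ?s * ?t \<doteq> (if Q js then ?s else 0) * ?t"
        by (intro lcong_mult) auto
      moreover have "proj w q * (P u * prod_list (map branch js)) \<doteq> proj w q * (?s * ?t)"
        by (intro lcong_mult 1 lcong_refl)
      ultimately have "proj w q * (P u * prod_list (map branch js)) \<doteq> (if Q js then ?s * ?t else 0)"
        by (auto simp: mult.assoc intro: lcong_trans)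
      then show ?thesis using lcong_sym [OF 1] by (auto intro: lcong_trans)
    qed
    have zero: "P u * prod_list (map branch js) \<doteq> 0"
      if "js \<in> labelled es" "\<not> successively jarc js" for js
      using branch_product_zero [OF that(2)] js [OF that(1)] by (intro lcong_mult_zero) auto
    have expand: "phi (spath u es) \<doteq> (\<Sum>js\<in>labelled es. P u * prod_list (map branch js))"
      by (rule phi_spath_expand [OF arcs])
    \<comment> \<open>By \<open>agree\<close> all summands that come from paths are fixed or all are
      annihilated; the other summands are zero anyway.\<close>
    have "proj w q * phi (spath u es) \<doteq> phi (spath u es) \<or> proj w q * phi (spath u es) \<doteq> 0"
    proof -
      have lhs: "proj w q * phi (spath u es) \<doteq>
          (\<Sum>js\<in>labelled es. proj w q * (P u * prod_list (map branch js)))"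
        using lcong_mult [OF lcong_refl expand, of "proj w q"] by (simp add: sum_distrib_left)
      show ?thesis
      proof (cases "\<exists>js\<in>labelled es. successively jarc js \<and> Q js")
        case True
        then have Q: "Q js" if "js \<in> labelled es" "successively jarc js" for js
          using agree that by blast
        have "proj w q * (P u * prod_list (map branch js)) \<doteq> P u * prod_list (map branch js)"
          if "js \<in> labelled es" for js
        proof (cases "successively jarc js")
          case True
          then show ?thesis using summand [OF that True] Q [OF that True] by simp
        next
          case False
          then show ?thesis
            using zero [OF that] lcong_mult_zero(1) lcong_sym lcong_trans by meson
        qed
        then show ?thesis
          using lcong_trans [OF lhs lcong_trans [OF lcong_sum lcong_sym [OF expand]]] by blast
      next
        case False
        have "proj w q * (P u * prod_list (map branch js)) \<doteq> 0" if "js \<in> labelled es" for js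
        proof (cases "successively jarc js")
          case True
          then show ?thesis using summand [OF that True] False that by auto
        next
          case False
          then show ?thesis using zero [OF that False] by (rule_tac lcong_mult_zero(1))
        qed
        then show ?thesis
          using lcong_trans [OF lhs lcong_sum_zero] by blast
      qed
    qed
    moreover have "phi (proj u es) = phi (spath u es) * phi (tpath u es)"
      by (simp add: proj_def)
    ultimately have "proj w q * phi (proj u es) \<doteq> phi (proj u es) \<or> proj w q * phi (proj u es) \<doteq> 0"
      using lcong_mult [of "proj w q * phi (spath u es)" "phi (spath u es)" "phi (tpath u es)" "phi (tpath u es)"]
        lcong_mult_zero(2) [of "proj w q * phi (spath u es)" "phi (tpath u es)"]
      by (auto simp: mult.assoc)
    moreover have "phi (proj u es) \<in> W"
      using diag.path [OF es(1)] unfolding W_def by blast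
    ultimately show ?thesis using W_cong W_zero by blast
  qed
  \<comment> \<open>Splitting \<open>1\<close> by \<open>sum_proj\<close> writes
    \<open>proj w q\<close> as a sum of terms each congruent to \<open>phi (proj u es)\<close> or to
    \<open>0\<close>.\<close>
  have "proj w q = proj w q * phi 1" by simp
  also have "\<dots> \<doteq> proj w q * phi (\<Sum>(u, es)\<in>npaths (K + m). proj u es)"
    by (intro lcong_mult phi_lcong lcong_sym [OF sum_proj] lcong_refl)
  also have "\<dots> = (\<Sum>(u, es)\<in>npaths (K + m). proj w q * phi (proj u es))"
    by (simp add: sum_distrib_left case_prod_unfold)
  finally have "proj w q \<in> W"
    by (rule W_cong [rotated]) (auto intro!: W_sum piece)
  then show thesis using that unfolding W_def by blast
qed

lemma diag_in_image:
  assumes "d \<in> diag"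
  shows "\<exists>d'\<in>diag. d \<doteq> phi d'"
  using assms
proof induction
  case zero
  show ?case using diag.zero by force
next
  case (path u p v)
  from proj_in_image [OF path] show ?case by blast
next
  case (diff d1 d2)
  then obtain d1' d2' where "d1' \<in> diag" "d1 \<doteq> phi d1'" "d2' \<in> diag" "d2 \<doteq> phi d2'"
    by blast
  then have "d1' - d2' \<in> diag" "d1 - d2 \<doteq> phi (d1' - d2')"
    by (auto intro: diag.diff lcong_diff)
  then show ?case by blast
next
  case (lcong d1 d2)
  then show ?case using lcong_trans by blast
qed

lemma Lambda_diagonal_iso: "Lambda E J \<in> ring_iso (diagonal_ring E) (diagonal_ring E)"
proof -
  have closed: "diagonal E \<subseteq> carrier (leavitt E)"
    by (auto simp: diagonal_eq qt_hom)
  have image: "Lambda E J ` diagonal E = diagonal E"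
  proof
    show "Lambda E J ` diagonal E \<subseteq> diagonal E"
      by (auto simp: diagonal_eq Lambda_qt intro: phi_diag [OF no_sinks])
    show "diagonal E \<subseteq> Lambda E J ` diagonal E"
    proof
      fix X assume "X \<in> diagonal E"
      then obtain d where "d \<in> diag" "X = qt d" by (auto simp: diagonal_eq)
      then obtain d' where "d' \<in> diag" "X = Lambda E J (qt d')"
        using diag_in_image by (auto simp: Lambda_qt qt_eq_iff)
      then show "X \<in> Lambda E J ` diagonal E" by (auto simp: diagonal_eq)
    qed
  qed
  have "inj_on (Lambda E J) (diagonal E)"
  proof (rule inj_onI)
    fix X Y assume XY: "X \<in> diagonal E" "Y \<in> diagonal E" "Lambda E J X = Lambda E J Y"
    then obtain d d' where d: "d \<in> diag" "d' \<in> diag" "X = qt d" "Y = qt d'"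
      by (auto simp: diagonal_eq)
    then have "phi (d - d') \<doteq> 0"
      using XY(3) by (simp add: Lambda_qt qt_eq_iff flip: lcong_zero_iff)
    with no_sinks diag.diff [OF d(1,2)] have "d - d' \<doteq> 0"
      by (rule phi_diag_injective)
    then show "X = Y" using d by (simp add: qt_eq_iff flip: lcong_zero_iff)
  qed
  with image have "bij_betw (Lambda E J) (diagonal E) (diagonal E)"
    by (simp add: bij_betw_def)
  moreover have "Lambda E J \<in> ring_hom (diagonal_ring E) (diagonal_ring E)"
  proof (rule ring_hom_memI)
    fix X Y assume "X \<in> carrier (diagonal_ring E)" "Y \<in> carrier (diagonal_ring E)"
    then have "X \<in> diagonal E" "Y \<in> diagonal E" by (simp_all add: diagonal_ring_def)
    moreover from this have "X \<in> carrier (leavitt E)" "Y \<in> carrier (leavitt E)" "Lambda E J X \<in> diagonal E"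
      using closed image by blast+
    ultimately show "Lambda E J X \<in> carrier (diagonal_ring E)"
      "Lambda E J (X \<otimes>\<^bsub>diagonal_ring E\<^esub> Y) = Lambda E J X \<otimes>\<^bsub>diagonal_ring E\<^esub> Lambda E J Y"
      "Lambda E J (X \<oplus>\<^bsub>diagonal_ring E\<^esub> Y) = Lambda E J X \<oplus>\<^bsub>diagonal_ring E\<^esub> Lambda E J Y"
      using ring_hom_mult [OF Lambda_hom] ring_hom_add [OF Lambda_hom]
      by (simp_all add: diagonal_ring_def)
  qed (use ring_hom_one [OF Lambda_hom] in \<open>simp add: diagonal_ring_def\<close>)
  ultimately show ?thesis
    by (simp add: ring_iso_def diagonal_ring_def)
qed

end

theorem theorem5p5:
  fixes E :: "('v,'e) pre_digraph"
    and J :: "(('v,'e) path \<times> ('v,'e) path) set"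
  assumes "fin_digraph E"
    and "no_sinks E"
    and "no_sources E"
    and "all_cycles_have_exits E"
    and "admissible E J"
    and "\<forall>a\<in>arcs (coding_graph E J). non_negative_edge E a"
    and "\<not> (\<exists>\<omega>. wf_digraph.closed_w (coding_graph E J) \<omega> \<and> non_positive_path E \<omega>)"
    and "left_synchronizing E J"
  shows "Lambda E J \<in> ring_iso (diagonal_ring E) (diagonal_ring E)"
proof -
  interpret fin_digraph E by fact
  interpret synchronizing_coding E J
    by unfold_locales (fact assms)+
  show ?thesis by (rule Lambda_diagonal_iso)
qed

end
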